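(* Let $G$ and $F$ be connected graphs with no loops and no parallel edges such that $E(G)=E(F)=E$, $M_t(G)=M_t(F)$, and $M(G)\neq M(F)$. Let $X\subseteq E$ be such that $R=G[X]$ is a quasi-Hamiltonian cycle in $G$ and $F[X]$ is a spanning tree in $F$. Suppose that $G$ has exactly two spokes $s_1$ and $s_2$, and that their end-vertices $r_1$ and $r_2$ in $R$ are the end-vertices of an edge $x$ of $R$. Then: (c1) the graphs $G$ and $F$ are isomorphic; (c2) $F$ can be obtained from $G$ (up to the names of vertices) by a series of Whitney 2-vertex cut switches and, possibly, also by exchanging the two edges $x$ and $s_i$ for some $i\in\{1,2\}$; and (c3) the graphs $G$ and $F$ are 2-connected.
   Context: Graphs are finite; each edge has two distinct end-vertices. The cycle matroid $M(G)$ is the matroid on $E(G)$ whose bases are the edge sets of maximal forests of $G$. The truncation $M_t$ of a matroid $M$ with set of bases $\mathcal{B}(M)$ is the matroid on the same ground set with set of bases $\{B\setminus\{x\}: B\in\mathcal{B}(M),\ x\in B\}$; put $M_t(G)=(M(G))_t$. Equality of matroids is equality on the labelled ground set. For $X\subseteq E(G)$, $G[X]$ is the subgraph with edge set $X$ whose vertices are those incident to at least one edge in $X$. A cycle $Q$ of $G$ is quasi-Hamiltonian if $V(Q)=V(G)\setminus\{q\}$ for some $q\in V(G)$. With $R=G[X]$ a quasi-Hamiltonian cycle, let $c$ be the unique vertex of $G$ not in $R$; a spoke of $G$ is an edge of $G$ incident to $c$. A Whitney 2-vertex cut switch (Whitney twist): if $G$ is the union of two edge-disjoint subgraphs $A$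 and $B$ sharing exactly two vertices $u,v$, then every edge of $A$ incident to $u$ is made incident to $v$ instead, and vice versa. Exchanging two edges $e,f$ means interchanging their labels, i.e. interchanging the end-vertex pairs $\phi(e)$ and $\phi(f)$ of the incidence function $\phi$.
   Formalization: Part (c2) is asserted only when G has at least 5 vertices; on 4 vertices (G being K4 minus an edge) it can fail, since F need not contain the triangle {x, s1, s2}, which every switch and exchange preserves. Parts (c1) and (c3) are proved without this restriction. *)

theory Defs
  imports "HOL-Combinatorics.Transposition"
begin

text \<open>Finite multigraphs with labelled edges; \<open>ends\<close> is the incidence function.
  Its values outside \<open>edges\<close> are irrelevant.\<close>

record ('v, 'e) mgraph =
  verts :: "'v set"
  edges :: "'e set"
  ends :: "'e \<Rightarrow> 'v set"

definition wf_graph :: "('v, 'e) mgraph \<Rightarrow> bool" where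
  "wf_graph G \<longleftrightarrow> finite (verts G) \<and> finite (edges G) \<and>
     (\<forall>e\<in>edges G. ends G e \<subseteq> verts G \<and> card (ends G e) = 2)"

text \<open>Loops are already excluded by \<open>wf_graph\<close>.\<close>

definition simple_graph :: "('v, 'e) mgraph \<Rightarrow> bool" where
  "simple_graph G \<longleftrightarrow> wf_graph G \<and>
     (\<forall>e\<in>edges G. \<forall>f\<in>edges G. ends G e = ends G f \<longrightarrow> e = f)"

definition subgraph :: "('v, 'e) mgraph \<Rightarrow> ('v, 'e) mgraph \<Rightarrow> bool" where
  "subgraph H G \<longleftrightarrow> wf_graph H \<and> verts H \<subseteq> verts G \<and> edges H \<subseteq> edges G \<and>
     (\<forall>e\<in>edges H. ends H e = ends G e)"

definition edge_induced :: "('v, 'e) mgraph \<Rightarrow> 'e set \<Rightarrow> ('v, 'e) mgraph" where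
  "edge_induced G X = \<lparr>verts = (\<Union>e\<in>X. ends G e), edges = X, ends = ends G\<rparr>"

definition delete_vertex :: "('v, 'e) mgraph \<Rightarrow> 'v \<Rightarrow> ('v, 'e) mgraph" where
  "delete_vertex G v =
     \<lparr>verts = verts G - {v}, edges = {e \<in> edges G. v \<notin> ends G e}, ends = ends G\<rparr>"

definition adjacency :: "('v, 'e) mgraph \<Rightarrow> ('v \<times> 'v) set" where
  "adjacency G = {(u, v). \<exists>e\<in>edges G. ends G e = {u, v}}"

definition connected_graph :: "('v, 'e) mgraph \<Rightarrow> bool" where
  "connected_graph G \<longleftrightarrow> verts G \<noteq> {} \<and>
     (\<forall>u\<in>verts G. \<forall>v\<in>verts G. (u, v) \<in> (adjacency G)\<^sup>*)"

definition two_connected :: "('v, 'e) mgraph \<Rightarrow> bool" where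
  "two_connected G \<longleftrightarrow> card (verts G) \<ge> 3 \<and> connected_graph G \<and>
     (\<forall>v\<in>verts G. connected_graph (delete_vertex G v))"

definition degree :: "('v, 'e) mgraph \<Rightarrow> 'v \<Rightarrow> nat" where
  "degree G v = card {e \<in> edges G. v \<in> ends G e}"

text \<open>A cycle is a connected 2-regular graph; two parallel edges form a cycle.\<close>

definition is_cycle :: "('v, 'e) mgraph \<Rightarrow> bool" where
  "is_cycle C \<longleftrightarrow> wf_graph C \<and> connected_graph C \<and> (\<forall>v\<in>verts C. degree C v = 2)"

definition is_forest :: "('v, 'e) mgraph \<Rightarrow> bool" where
  "is_forest T \<longleftrightarrow> wf_graph T \<and> (\<nexists>C. subgraph C T \<and> is_cycle C)"

definition spanning_tree :: "('v, 'e) mgraph \<Rightarrow> ('v, 'e) mgraph \<Rightarrow> bool" where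
  "spanning_tree T G \<longleftrightarrow>
     subgraph T G \<and> is_forest T \<and> connected_graph T \<and> verts T = verts G"

definition quasi_hamiltonian_cycle :: "('v, 'e) mgraph \<Rightarrow> ('v, 'e) mgraph \<Rightarrow> bool" where
  "quasi_hamiltonian_cycle Q G \<longleftrightarrow>
     subgraph Q G \<and> is_cycle Q \<and> (\<exists>q\<in>verts G. verts Q = verts G - {q})"

text \<open>A matroid is given by its ground set and its set of bases, so that equality of
  matroids is equality on the labelled ground set.\<close>

record 'e matroid =
  ground :: "'e set"
  bases :: "'e set set"

definition forest_edge_set :: "('v, 'e) mgraph \<Rightarrow> 'e set \<Rightarrow> bool" where
  "forest_edge_set G B \<longleftrightarrow> B \<subseteq> edges G \<and> is_forest (edge_induced G B)"

definition cycle_matroid :: "('v, 'e) mgraph \<Rightarrow> 'e matroid" where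
  "cycle_matroid G = \<lparr>ground = edges G,
     bases = {B. forest_edge_set G B \<and> (\<forall>B'. forest_edge_set G B' \<and> B \<subseteq> B' \<longrightarrow> B' = B)}\<rparr>"

definition truncation :: "'e matroid \<Rightarrow> 'e matroid" where
  "truncation M = \<lparr>ground = ground M, bases = {B - {x} | B x. B \<in> bases M \<and> x \<in> B}\<rparr>"

definition isomorphic :: "('v, 'e) mgraph \<Rightarrow> ('w, 'f) mgraph \<Rightarrow> bool" where
  "isomorphic G H \<longleftrightarrow> (\<exists>\<alpha> \<beta>. bij_betw \<alpha> (verts G) (verts H) \<and> bij_betw \<beta> (edges G) (edges H) \<and>
     (\<forall>e\<in>edges G. ends H (\<beta> e) = \<alpha> ` ends G e))"

text \<open>Equality of graphs up to the names of vertices: edge labels are kept.\<close>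

definition same_up_to_vertex_names :: "('v, 'e) mgraph \<Rightarrow> ('w, 'e) mgraph \<Rightarrow> bool" where
  "same_up_to_vertex_names G H \<longleftrightarrow> edges G = edges H \<and>
     (\<exists>\<alpha>. bij_betw \<alpha> (verts G) (verts H) \<and> (\<forall>e\<in>edges G. ends H e = \<alpha> ` ends G e))"

definition whitney_switch :: "('v, 'e) mgraph \<Rightarrow> ('v, 'e) mgraph \<Rightarrow> bool" where
  "whitney_switch G H \<longleftrightarrow> (\<exists>A B u v.
     subgraph A G \<and> subgraph B G \<and>
     verts A \<union> verts B = verts G \<and> edges A \<union> edges B = edges G \<and>
     edges A \<inter> edges B = {} \<and> u \<noteq> v \<and> verts A \<inter> verts B = {u, v} \<and>
     H = G\<lparr>ends := \<lambda>e. if e \<in> edges A then transpose u v ` ends G e else ends G e\<rparr>)"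

definition exchange_edges :: "'e \<Rightarrow> 'e \<Rightarrow> ('v, 'e) mgraph \<Rightarrow> ('v, 'e) mgraph" where
  "exchange_edges e f G = G\<lparr>ends := (ends G)(e := ends G f, f := ends G e)\<rparr>"

text \<open>\<open>H\<close> arises from \<open>G\<close> by a series of switches in which, at one arbitrary point,
  a single exchange of \<open>x\<close> with some \<open>s \<in> S\<close> may be inserted.\<close>

definition switches_and_exchange ::
    "'e \<Rightarrow> 'e set \<Rightarrow> ('v, 'e) mgraph \<Rightarrow> ('v, 'e) mgraph \<Rightarrow> bool" where
  "switches_and_exchange x S G H \<longleftrightarrow> (\<exists>G1 G2. whitney_switch\<^sup>*\<^sup>* G G1 \<and>
     (G2 = G1 \<or> (\<exists>s\<in>S. G2 = exchange_edges x s G1)) \<and> whitney_switch\<^sup>*\<^sup>* G2 H)"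

end

theory Submission
  imports Defs
begin

text \<open>Over \<open>GF(2)\<close>, a forest is an edge set without a nonempty subset of even degrees. Let \<open>m = |X|\<close>,
  so \<open>|V(G)| = m + 1\<close> and edge sets with fewer than \<open>m\<close> elements are forests of \<open>G\<close> iff they are
  forests of \<open>F\<close>. A chord of \<open>R\<close> would yield two even sets of \<open>G\<close> smaller than \<open>m\<close> whose
  counterparts in \<open>F\<close> sum to an even set inside the tree \<open>X\<close>; so \<open>G\<close> is the theta graph
  \<open>R + s1 + s2\<close>. If \<open>m \<ge> 4\<close>, the triangle \<open>{x, s1, s2}\<close> survives in \<open>F\<close>, while the cycle that \<open>s1\<close>
  closes with \<open>X\<close> and its sum with the triangle both have at least \<open>m\<close> edges. This forces one
  of them to be \<open>X - x + s\<close> for a spoke \<open>s\<close>, so \<open>F\<close> is the theta graph of \<open>G\<close> with \<open>x\<close> and \<open>s\<close> exchanged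
  and the long path reordered; a Whitney switch at a vertex of degree 2 swaps the two
  edges there. If \<open>m = 3\<close>, both graphs are \<open>K4\<close> minus an edge.\<close>

section \<open>Even edge sets and paths\<close>

text \<open>The elements of the cycle space over \<open>GF(2)\<close>. Finiteness is demanded
  because \<open>card\<close> of an infinite set is 0, which is even.\<close>

definition even_set :: "('e \<Rightarrow> 'v set) \<Rightarrow> 'e set \<Rightarrow> bool" where
  "even_set f D \<longleftrightarrow> finite D \<and> (\<forall>v. even (card {e \<in> D. v \<in> f e}))"

text \<open>Linear independence over \<open>GF(2)\<close> of the incidence vectors of the edges in
  \<open>B\<close>.\<close>

definition indep :: "('e \<Rightarrow> 'v set) \<Rightarrow> 'e set \<Rightarrow> bool" where
  "indep f B \<longleftrightarrow> (\<forall>D \<subseteq> B. even_set f D \<longrightarrow> D = {})"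

definition links :: "('e \<Rightarrow> 'v set) \<Rightarrow> 'e set \<Rightarrow> ('v \<times> 'v) set" where
  "links f D = {(u, v). \<exists>e\<in>D. f e = {u, v}}"

text \<open>Vertices and edges are kept in separate lists, so that the edge labels along a path can
  later be permuted while its vertices stay fixed. A single vertex without edges counts as a
  path.\<close>

definition vpath :: "('e \<Rightarrow> 'v set) \<Rightarrow> 'v list \<Rightarrow> 'e list \<Rightarrow> bool" where
  "vpath f vs es \<longleftrightarrow> distinct vs \<and> length vs = Suc (length es) \<and>
     (\<forall>i<length es. f (es ! i) = {vs ! i, vs ! Suc i})"

lemma indep_mono: "indep f B \<Longrightarrow> A \<subseteq> B \<Longrightarrow> indep f A"
  unfolding indep_def by blast

text \<open>At each vertex, the degrees in \<open>A\<close> and in \<open>B\<close> add up to the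
  degree in the symmetric difference plus twice the degree in \<open>A \<inter> B\<close>.\<close>

lemma even_set_sym_diff:
  assumes "even_set f A" "even_set f B"
  shows "even_set f (sym_diff A B)"
proof -
  have fin: "finite A" "finite B" using assms by (auto simp: even_set_def)
  have "even (card {e \<in> sym_diff A B. v \<in> f e})" for v
  proof -
    let ?A = "{e \<in> A. v \<in> f e}" and ?B = "{e \<in> B. v \<in> f e}"
    have eq: "{e \<in> sym_diff A B. v \<in> f e} = (?A - ?B) \<union> (?B - ?A)" by auto
    have "card ((?A - ?B) \<union> (?B - ?A)) = card (?A - ?B) + card (?B - ?A)"
      using fin by (intro card_Un_disjoint) auto
    moreover have "card ?A = card (?A - ?B) + card (?A \<inter> ?B)"
      using fin by (subst card_Un_disjoint[symmetric]) (auto intro: arg_cong[where f = card])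
    moreover have "card ?B = card (?B - ?A) + card (?A \<inter> ?B)"
      using fin by (subst card_Un_disjoint[symmetric]) (auto intro: arg_cong[where f = card])
    moreover have "even (card ?A)" "even (card ?B)" using assms by (auto simp: even_set_def)
    ultimately show ?thesis unfolding eq by presburger
  qed
  then show ?thesis using fin by (auto simp: even_set_def)
qed

lemma even_set_another_edge:
  assumes "even_set f D" "e \<in> D" "v \<in> f e"
  obtains e' where "e' \<in> D" "e' \<noteq> e" "v \<in> f e'"
proof -
  have "{e' \<in> D. v \<in> f e'} \<noteq> {e}" using assms(1)
    by (metis even_set_def is_singletonI is_singleton_altdef odd_one)
  then show ?thesis using assms that by blast
qed

text \<open>An even set continues beyond both ends of an edge \<open>e\<close>. A single further
  edge cannot serve both ends, since it would be parallel to \<open>e\<close>.\<close>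

lemma even_set_card_ge_3:
  assumes "even_set f D" "D \<noteq> {}" "inj_on f D" "\<And>e. e \<in> D \<Longrightarrow> card (f e) = 2"
  shows "3 \<le> card D"
proof -
  obtain e where e: "e \<in> D" using assms(2) by blast
  obtain a b where ab: "f e = {a, b}" "a \<noteq> b" using assms(4)[OF e] by (meson card_2_iff)
  obtain e' where e': "e' \<in> D" "e' \<noteq> e" "a \<in> f e'"
    using even_set_another_edge[OF assms(1) e, of a] ab by blast
  obtain e'' where e'': "e'' \<in> D" "e'' \<noteq> e" "b \<in> f e''"
    using even_set_another_edge[OF assms(1) e, of b] ab by blast
  have "f e' \<noteq> f e" using assms(3) e e' by (meson inj_onD)
  then have "e'' \<noteq> e'" using ab e'(3) e''(3) assms(4)[OF e'(1)] by (auto simp: card_2_iff)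
  then have "card {e, e', e''} = 3" using e'(2) e''(2) by auto
  moreover have "card {e, e', e''} \<le> card D"
    using e e' e'' assms(1) by (intro card_mono) (auto simp: even_set_def)
  ultimately show ?thesis by simp
qed

lemma links_mono: "A \<subseteq> B \<Longrightarrow> links f A \<subseteq> links f B"
  unfolding links_def by blast

lemma sym_links: "sym (links f D)"
  unfolding links_def sym_def by (auto simp: insert_commute)

lemma sym_links_rtrancl: "(u, v) \<in> (links f D)\<^sup>* \<Longrightarrow> (v, u) \<in> (links f D)\<^sup>*"
  using sym_links sym_rtrancl by (metis symD)

text \<open>Otherwise the component of \<open>a\<close> in \<open>D - {x}\<close> would have exactly one vertex of odd degree.\<close>

lemma even_set_reconnects:
  assumes ev: "even_set f D" and x: "x \<in> D" "f x = {a, b}"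
    and two: "\<And>e. e \<in> D \<Longrightarrow> card (f e) = 2"
  shows "(a, b) \<in> (links f (D - {x}))\<^sup>*"
proof (rule ccontr)
  assume nb: "(a, b) \<notin> (links f (D - {x}))\<^sup>*"
  have fin: "finite D" using ev by (simp add: even_set_def)
  let ?D = "D - {x}"
  define S where "S = {v. (a, v) \<in> (links f ?D)\<^sup>*}"
  have aS: "a \<in> S" and bS: "b \<notin> S" using nb by (auto simp: S_def)
  have "S \<subseteq> insert a (\<Union>(f ` D))"
  proof
    fix v assume "v \<in> S"
    then have "(a, v) \<in> (links f ?D)\<^sup>*" by (simp add: S_def)
    then show "v \<in> insert a (\<Union>(f ` D))" by (cases rule: rtranclE) (auto simp: links_def)
  qed
  moreover have "finite (f e)" if "e \<in> D" for e
    using two[OF that] by (metis card.infinite zero_neq_numeral)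
  ultimately have finS: "finite S" using fin by (meson finite_UN finite_insert finite_subset)
  have closed: "f e \<subseteq> S \<or> f e \<inter> S = {}" if "e \<in> ?D" for e
  proof -
    have "card (f e) = 2" using two that by blast
    then obtain u v where uv: "f e = {u, v}" by (meson card_2_iff)
    then have "(u, v) \<in> links f ?D" "(v, u) \<in> links f ?D" using that
      by (auto simp: links_def insert_commute)
    then have "u \<in> S \<longleftrightarrow> v \<in> S" unfolding S_def by (auto intro: rtrancl_into_rtrancl)
    then show ?thesis using uv by auto
  qed
  \<comment> \<open>Double counting of the incidences between \<open>S\<close> and
    \<open>?D\<close>: each edge of \<open>?D\<close> has both ends or no end in \<open>S\<close>,
    so the degrees over \<open>S\<close> have an even sum.\<close>
  have "(\<Sum>v\<in>S. card {e \<in> ?D. v \<in> f e}) = (\<Sum>v\<in>S. \<Sum>e\<in>?D. if v \<in> f e then 1 else 0)"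
    using fin by (intro sum.cong) (auto simp: sum.If_cases Int_def)
  also have "\<dots> = (\<Sum>e\<in>?D. \<Sum>v\<in>S. if v \<in> f e then 1 else 0)" by (rule sum.swap)
  also have "\<dots> = (\<Sum>e\<in>?D. card (S \<inter> f e))" using finS by (intro sum.cong) (auto simp: sum.If_cases)
  also have "even \<dots>"
  proof (intro dvd_sum)
    fix e assume e: "e \<in> ?D"
    from closed[OF e] have "S \<inter> f e = f e \<or> S \<inter> f e = {}" by blast
    then show "even (card (S \<inter> f e))" using two[of e] e by auto
  qed
  finally have ev_sum: "even (\<Sum>v\<in>S. card {e \<in> ?D. v \<in> f e})" .
  have "(\<Sum>v\<in>S. card {e \<in> ?D. v \<in> f e}) =
      card {e \<in> ?D. a \<in> f e} + (\<Sum>v\<in>S - {a}. card {e \<in> ?D. v \<in> f e})"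
    using finS aS by (rule sum.remove)
  \<comment> \<open>Inside \<open>S\<close> the removal of \<open>x\<close> changes the degree at
    \<open>a\<close> only, because \<open>b\<close> lies outside \<open>S\<close>.\<close>
  moreover have "even (\<Sum>v\<in>S - {a}. card {e \<in> ?D. v \<in> f e})"
  proof (intro dvd_sum)
    fix v assume "v \<in> S - {a}"
    then have "v \<notin> f x" using bS x by auto
    then have "{e \<in> ?D. v \<in> f e} = {e \<in> D. v \<in> f e}" by auto
    then show "even (card {e \<in> ?D. v \<in> f e})" using ev by (simp add: even_set_def)
  qed
  moreover have "odd (card {e \<in> ?D. a \<in> f e})"
  proof -
    have "{e \<in> D. a \<in> f e} = insert x {e \<in> ?D. a \<in> f e}" using x by auto
    then have "card {e \<in> D. a \<in> f e} = Suc (card {e \<in> ?D. a \<in> f e})" using fin by simp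
    then show ?thesis using ev by (metis even_Suc even_set_def)
  qed
  ultimately show False using ev_sum by simp
qed

section \<open>Cutting, extending and closing paths\<close>

lemma vpath_take:
  assumes "vpath f vs es" "i < length vs"
  shows "vpath f (take (Suc i) vs) (take i es)"
  using assms unfolding vpath_def by (auto simp: min_def)

lemma vpath_drop:
  assumes "vpath f vs es" "i < length vs"
  shows "vpath f (drop i vs) (drop i es)"
  using assms unfolding vpath_def by auto

lemma vpath_snoc:
  assumes "vpath f vs es" "f e = {last vs, v}" "v \<notin> set vs"
  shows "vpath f (vs @ [v]) (es @ [e])"
proof -
  have "vs \<noteq> []" using assms(1) by (auto simp: vpath_def)
  then have "last vs = vs ! length es" using assms(1) by (simp add: last_conv_nth vpath_def)
  then show ?thesis using assms unfolding vpath_def by (auto simp: nth_append less_Suc_eq)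
qed

lemma vpath_nonempty: "vpath f vs es \<Longrightarrow> vs \<noteq> []"
  unfolding vpath_def by auto

text \<open>Induction along the walk: a new vertex extends the path, and a vertex met before cuts
  the path back to it.\<close>

lemma vpath_if_linked:
  assumes "(a, b) \<in> (links f D)\<^sup>*"
  shows "\<exists>vs es. vpath f vs es \<and> set es \<subseteq> D \<and> hd vs = a \<and> last vs = b"
  using assms
proof (induction rule: rtrancl_induct)
  case base
  have "vpath f [a] [] \<and> set [] \<subseteq> D \<and> hd [a] = a \<and> last [a] = a" by (simp add: vpath_def)
  then show ?case by blast
next
  case (step y z)
  then obtain vs es where p: "vpath f vs es" "set es \<subseteq> D" "hd vs = a" "last vs = y" by blast
  obtain e where e: "e \<in> D" "f e = {y, z}" using step(2) by (auto simp: links_def)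
  show ?case
  proof (cases "z \<in> set vs")
    case True
    then obtain i where i: "i < length vs" "vs ! i = z" by (auto simp: in_set_conv_nth)
    have "vpath f (take (Suc i) vs) (take i es)" using p(1) i(1) by (rule vpath_take)
    moreover have "hd (take (Suc i) vs) = a" using p(3) by (simp add: hd_take)
    moreover have "last (take (Suc i) vs) = z" using i by (simp add: take_Suc_conv_app_nth)
    moreover have "set (take i es) \<subseteq> D" using p(2) by (meson order_trans set_take_subset)
    ultimately show ?thesis by blast
  next
    case False
    have "vpath f (vs @ [z]) (es @ [e])" using p e False by (intro vpath_snoc) auto
    moreover have "hd (vs @ [z]) = a" using p(3) vpath_nonempty[OF p(1)] by simp
    ultimately show ?thesis using p(2) e(1)
      by (metis Un_subset_iff empty_subsetI insert_subset last_snoc list.set(1) list.simps(15) set_append)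
  qed
qed

text \<open>If the same edge stood at positions \<open>i < j\<close>, then \<open>vs ! i\<close>
  would reappear at position \<open>j\<close> or \<open>Suc j\<close>.\<close>

lemma vpath_distinct_edges:
  assumes "vpath f vs es"
  shows "distinct es"
proof -
  have "es ! i \<noteq> es ! j" if "i < j" "j < length es" for i j
  proof
    assume "es ! i = es ! j"
    then have "{vs ! i, vs ! Suc i} = {vs ! j, vs ! Suc j}" using assms that
      unfolding vpath_def by (metis less_trans)
    then have "vs ! i = vs ! j \<or> vs ! i = vs ! Suc j" by blast
    then show False using assms that unfolding vpath_def by (auto simp: nth_eq_iff_index_eq)
  qed
  then show ?thesis unfolding distinct_conv_nth by (metis nat_neq_iff)
qed

text \<open>The predecessor index is written as \<open>Suc j = i\<close>, which has no solution at
  the first vertex, where \<open>i - 1\<close> would be 0.\<close>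

lemma vpath_incident:
  assumes "vpath f vs es" "i < length vs"
  shows "{e \<in> set es. vs ! i \<in> f e} = (\<lambda>j. es ! j) ` {j. j < length es \<and> (j = i \<or> Suc j = i)}"
  using assms unfolding vpath_def by (auto simp: in_set_conv_nth nth_eq_iff_index_eq)

lemma vpath_linked:
  assumes p: "vpath f vs es" and "u \<in> set vs" "v \<in> set vs"
  shows "(u, v) \<in> (links f (set es))\<^sup>*"
proof -
  have "(vs ! 0, vs ! i) \<in> (links f (set es))\<^sup>*" if "i < length vs" for i
    using that
  proof (induction i)
    case (Suc i)
    then have "(vs ! i, vs ! Suc i) \<in> links f (set es)"
      using p unfolding vpath_def links_def by (auto intro!: bexI[of _ "es ! i"])
    then show ?case using Suc by (simp add: rtrancl_into_rtrancl)
  qed simp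
  then show ?thesis using assms(2,3) by (metis in_set_conv_nth rtrancl_trans sym_links_rtrancl)
qed

text \<open>A path without edges still has one vertex, which no edge covers; hence
  \<open>es \<noteq> []\<close>.\<close>

lemma vpath_vertices:
  assumes p: "vpath f vs es" and "es \<noteq> []"
  shows "\<Union>(f ` set es) = set vs"
proof
  show "\<Union>(f ` set es) \<subseteq> set vs"
    using p unfolding vpath_def by (fastforce simp: in_set_conv_nth[of _ es])
  show "set vs \<subseteq> \<Union>(f ` set es)"
  proof
    fix v assume "v \<in> set vs"
    then obtain i where i: "i < length vs" "v = vs ! i" by (auto simp: in_set_conv_nth)
    show "v \<in> \<Union>(f ` set es)"
    proof (cases i)
      case 0
      then show ?thesis using p i assms(2) unfolding vpath_def
        by (auto intro!: bexI[of _ "es ! 0"])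
    next
      case (Suc j)
      then show ?thesis using p i unfolding vpath_def by (auto intro!: bexI[of _ "es ! j"])
    qed
  qed
qed

text \<open>An inner vertex meets two path edges; each of the two end-vertices meets one path edge
  and the closing edge \<open>x\<close>.\<close>

lemma closed_vpath_degree:
  assumes p: "vpath f vs es" and "es \<noteq> []" and x: "x \<notin> set es" "f x = {hd vs, last vs}"
  shows "card {e \<in> insert x (set es). v \<in> f e} = (if v \<in> set vs then 2 else 0)"
proof (cases "v \<in> set vs")
  case True
  then obtain i where i: "i < length vs" "v = vs ! i" by (auto simp: in_set_conv_nth)
  have len: "length vs = Suc (length es)" "distinct vs" using p by (auto simp: vpath_def)
  have ne: "vs \<noteq> []" using len by auto
  have fx: "v \<in> f x \<longleftrightarrow> i = 0 \<or> i = length es"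
    using x i len ne by (auto simp: hd_conv_nth last_conv_nth nth_eq_iff_index_eq)
  let ?I = "{e \<in> set es. v \<in> f e}"
  have I: "?I = (\<lambda>j. es ! j) ` {j. j < length es \<and> (j = i \<or> Suc j = i)}"
    unfolding i(2) by (rule vpath_incident[OF p i(1)])
  have "card ?I = card {j. j < length es \<and> (j = i \<or> Suc j = i)}"
    unfolding I by (intro card_image inj_onI) (auto simp: nth_eq_iff_index_eq[OF vpath_distinct_edges[OF p]])
  also have "{j. j < length es \<and> (j = i \<or> Suc j = i)} =
    (if i = 0 then {0} else if i = length es then {i - 1} else {i - 1, i})"
    using i(1) len assms(2) by auto
  finally have c: "card ?I = (if v \<in> f x then 1 else 2)" using fx by auto
  have "{e \<in> insert x (set es). v \<in> f e} = (if v \<in> f x then insert x ?I else ?I)" by auto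
  then show ?thesis using c x(1) True by auto
next
  case False
  then have "v \<notin> f e" if "e \<in> set es" for e
    using that vpath_vertices[OF p assms(2)] by blast
  moreover have "v \<notin> f x" using False x vpath_nonempty[OF p] by (auto)
  ultimately show ?thesis using False by auto
qed

lemma closed_vpath_even:
  assumes p: "vpath f vs es" and "es \<noteq> []" and x: "x \<notin> set es" "f x = {hd vs, last vs}"
  shows "even_set f (insert x (set es))"
  unfolding even_set_def using closed_vpath_degree[OF assms] by simp

section \<open>Forests and bases\<close>

lemma closed_vpath_is_cycle:
  assumes wf: "wf_graph G" and p: "vpath (ends G) vs es" and "es \<noteq> []"
    and x: "x \<notin> set es" "ends G x = {hd vs, last vs}" and sub: "insert x (set es) \<subseteq> edges G"
  shows "is_cycle (edge_induced G (insert x (set es)))"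
proof -
  let ?C = "edge_induced G (insert x (set es))"
  have V: "verts ?C = set vs"
    using vpath_vertices[OF p assms(3)] x vpath_nonempty[OF p] by (auto simp: edge_induced_def)
  have "links (ends G) (set es) \<subseteq> adjacency ?C"
    by (auto simp: links_def adjacency_def edge_induced_def)
  then have "connected_graph ?C" unfolding connected_graph_def V
    using vpath_linked[OF p] vpath_nonempty[OF p] rtrancl_mono by (metis set_empty subsetD)
  moreover have "wf_graph ?C" using wf sub V
    unfolding wf_graph_def by (auto simp: edge_induced_def)
  moreover have "degree ?C v = 2" if "v \<in> verts ?C" for v
    using closed_vpath_degree[OF p assms(3) x, of v] that unfolding V
    by (simp add: degree_def edge_induced_def)
  ultimately show ?thesis by (simp add: is_cycle_def)
qed

text \<open>A converse to \<open>even_set_reconnects\<close>: a path in \<open>A\<close> between the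
  ends of \<open>x\<close> is closed up by \<open>x\<close>. The path has an edge because
  \<open>a \<noteq> b\<close>.\<close>

lemma linked_even_set:
  assumes "x \<notin> A" "f x = {a, b}" "a \<noteq> b" "(a, b) \<in> (links f A)\<^sup>*"
  obtains vs es where "vpath f vs es" "set es \<subseteq> A" "hd vs = a" "last vs = b" "es \<noteq> []"
    "even_set f (insert x (set es))"
proof -
  obtain vs es where p: "vpath f vs es" "set es \<subseteq> A" "hd vs = a" "last vs = b"
    using vpath_if_linked[OF assms(4)] by blast
  have "es \<noteq> []" using p assms(3) by (auto simp: vpath_def length_Suc_conv)
  moreover have "even_set f (insert x (set es))"
    using p assms \<open>es \<noteq> []\<close> by (intro closed_vpath_even) auto
  ultimately show ?thesis using p that by blast
qed

text \<open>The incidence function \<open>f\<close> need agree with that of \<open>C\<close> only on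
  the edges of \<open>C\<close>, so the result can be read in any graph that contains the
  cycle.\<close>

lemma cycle_even_set:
  assumes C: "is_cycle C" and f: "\<And>e. e \<in> edges C \<Longrightarrow> ends C e = f e"
  shows "even_set f (edges C)" "edges C \<noteq> {}"
proof -
  have wf: "wf_graph C" using C by (simp add: is_cycle_def)
  have eq: "{e \<in> edges C. v \<in> f e} = {e \<in> edges C. v \<in> ends C e}" for v using f by auto
  have "even (card {e \<in> edges C. v \<in> f e})" for v
  proof (cases "v \<in> verts C")
    case True
    then have "card {e \<in> edges C. v \<in> f e} = 2" using C unfolding eq is_cycle_def degree_def by simp
    then show ?thesis by simp
  next
    case False
    then have "{e \<in> edges C. v \<in> ends C e} = {}" using wf by (auto simp: wf_graph_def)
    then show ?thesis unfolding eq by (simp only: card.empty even_zero)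
  qed
  then show "even_set f (edges C)" using wf by (simp add: even_set_def wf_graph_def)
  obtain v where "v \<in> verts C" using C by (auto simp: is_cycle_def connected_graph_def)
  then have "card {e \<in> edges C. v \<in> ends C e} = 2" using C by (simp add: is_cycle_def degree_def)
  then show "edges C \<noteq> {}" by auto
qed

text \<open>A cycle is a nonempty even set. Conversely, any edge \<open>x\<close> of a nonempty even
  set \<open>D\<close> has its ends still linked in \<open>D - {x}\<close>, and a path between them
  together with \<open>x\<close> is a cycle. All later matroid arguments use the
  \<open>GF(2)\<close> side.\<close>

lemma forest_edge_set_iff_indep:
  assumes wf: "wf_graph G"
  shows "forest_edge_set G B \<longleftrightarrow> B \<subseteq> edges G \<and> indep (ends G) B"
proof (intro iffI conjI)
  assume fB: "forest_edge_set G B"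
  then show sub: "B \<subseteq> edges G" by (simp add: forest_edge_set_def)
  show "indep (ends G) B" unfolding indep_def
  proof (intro allI impI, rule ccontr)
    fix D assume D: "D \<subseteq> B" "even_set (ends G) D" "D \<noteq> {}"
    then obtain x where x: "x \<in> D" by blast
    have two: "card (ends G e) = 2" if "e \<in> D" for e
      using that D(1) sub wf unfolding wf_graph_def by blast
    obtain a b where ab: "ends G x = {a, b}" "a \<noteq> b" using two[OF x] by (meson card_2_iff)
    have ln: "(a, b) \<in> (links (ends G) (D - {x}))\<^sup>*"
      using D(2) x ab(1) two by (rule even_set_reconnects)
    have nx: "x \<notin> D - {x}" by simp
    obtain vs es where p: "vpath (ends G) vs es" "set es \<subseteq> D - {x}" "hd vs = a"
      "last vs = b" "es \<noteq> []" "even_set (ends G) (insert x (set es))"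
      by (rule linked_even_set[where f = "ends G" and x = x and A = "D - {x}", OF nx ab ln])
    let ?C = "edge_induced G (insert x (set es))"
    have CD: "insert x (set es) \<subseteq> B" "x \<notin> set es" using p(2) x D(1) by blast+
    have "is_cycle ?C"
    proof (rule closed_vpath_is_cycle[OF wf p(1,5)])
      show "x \<notin> set es" "insert x (set es) \<subseteq> edges G" using CD sub by blast+
      show "ends G x = {hd vs, last vs}" using p ab by simp
    qed
    moreover from this have "subgraph ?C (edge_induced G B)"
      unfolding subgraph_def is_cycle_def using CD(1) by (auto simp: edge_induced_def)
    ultimately show False using fB by (auto simp: forest_edge_set_def is_forest_def)
  qed
next
  assume B: "B \<subseteq> edges G \<and> indep (ends G) B"
  have two: "finite (ends G e)" "card (ends G e) = 2" if "e \<in> B" for e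
    using wf B that unfolding wf_graph_def by (meson finite_subset subsetD)+
  have "finite B" using wf B unfolding wf_graph_def by (meson finite_subset)
  then have "wf_graph (edge_induced G B)" using two by (auto simp: wf_graph_def edge_induced_def)
  moreover have False if "subgraph C (edge_induced G B)" "is_cycle C" for C
  proof -
    have "ends C e = ends G e" if "e \<in> edges C" for e
      using \<open>subgraph C _\<close> that by (auto simp: subgraph_def edge_induced_def)
    from cycle_even_set[OF that(2) this] show False
      using B that(1) by (auto simp: indep_def subgraph_def edge_induced_def)
  qed
  ultimately show "forest_edge_set G B" using B by (auto simp: forest_edge_set_def is_forest_def)
qed

section \<open>Bases and the rank of a connected graph\<close>

lemma connected_card_le:
  assumes "finite V" "finite B" "\<And>e. e \<in> B \<Longrightarrow> f e \<subseteq> V"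
    and conn: "\<And>u v. u \<in> V \<Longrightarrow> v \<in> V \<Longrightarrow> (u, v) \<in> (links f B)\<^sup>*"
  shows "card V \<le> Suc (card B)"
proof (cases "V = {}")
  case False
  then obtain r where r: "r \<in> V" by blast
  \<comment> \<open>A vertex set is grown from \<open>r\<close>, one vertex at a time. Some edge
    always leaves \<open>S\<close>; it is new because its outer end \<open>q\<close> was not in
    \<open>S\<close>, so \<open>Suc k\<close> vertices span at least \<open>k\<close> edges.\<close>
  have "\<exists>S. S \<subseteq> V \<and> r \<in> S \<and> card S = Suc k \<and> k \<le> card {e \<in> B. f e \<subseteq> S}" if "Suc k \<le> card V" for k
    using that
  proof (induction k)
    case 0
    show ?case using r by (intro exI[of _ "{r}"]) auto
  next
    case (Suc k)
    then obtain S where S: "S \<subseteq> V" "r \<in> S" "card S = Suc k" "k \<le> card {e \<in> B. f e \<subseteq> S}" by auto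
    have finS: "finite S" using S(1) assms(1) by (rule finite_subset)
    have "S \<noteq> V" using S(3) Suc.prems by auto
    then obtain u where u: "u \<in> V" "u \<notin> S" using S by blast
    have "(r, u) \<in> (links f B)\<^sup>*" using conn r u by blast
    then have "\<exists>p q. p \<in> S \<and> q \<notin> S \<and> (p, q) \<in> links f B"
      using u(2) S(2) by (induction rule: rtrancl_induct) blast+
    then obtain p q e where pq: "p \<in> S" "q \<notin> S" "e \<in> B" "f e = {p, q}" by (auto simp: links_def)
    have "insert e {e \<in> B. f e \<subseteq> S} \<subseteq> {e \<in> B. f e \<subseteq> insert q S}" using pq by auto
    then have "card (insert e {e \<in> B. f e \<subseteq> S}) \<le> card {e \<in> B. f e \<subseteq> insert q S}"
      using assms(2) by (intro card_mono) auto
    then have "Suc k \<le> card {e \<in> B. f e \<subseteq> insert q S}" using pq S(4) assms(2) by auto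
    moreover have "insert q S \<subseteq> V" using S pq assms(3) by blast
    ultimately show ?case using S pq finS by (intro exI[of _ "insert q S"]) auto
  qed
  from this[of "card V - 1"] obtain S where "card V - 1 \<le> card {e \<in> B. f e \<subseteq> S}"
    using False assms(1) by (auto simp: Suc_le_eq card_gt_0_iff)
  also have "\<dots> \<le> card B" using assms(2) by (intro card_mono) auto
  finally show ?thesis by simp
qed simp

text \<open>Since \<open>indep\<close> passes to subsets, maximality can be tested by adding one
  edge at a time.\<close>

lemma base_iff:
  assumes "wf_graph G"
  shows "B \<in> bases (cycle_matroid G) \<longleftrightarrow> B \<subseteq> edges G \<and> indep (ends G) B \<and>
     (\<forall>e \<in> edges G - B. \<not> indep (ends G) (insert e B))"
proof -
  have "(\<forall>B'. B' \<subseteq> edges G \<and> indep (ends G) B' \<and> B \<subseteq> B' \<longrightarrow> B' = B) \<longleftrightarrow>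
    (\<forall>e \<in> edges G - B. \<not> indep (ends G) (insert e B))" (is "?L \<longleftrightarrow> ?R") if "B \<subseteq> edges G"
  proof
    assume L: ?L
    show ?R
    proof (intro ballI notI)
      fix e assume "e \<in> edges G - B" "indep (ends G) (insert e B)"
      then show False using L[rule_format, of "insert e B"] that by blast
    qed
  next
    assume R: ?R
    show ?L
    proof (intro allI impI, rule ccontr)
      fix B' assume B': "B' \<subseteq> edges G \<and> indep (ends G) B' \<and> B \<subseteq> B'" "B' \<noteq> B"
      then obtain e where "e \<in> B'" "e \<notin> B" by blast
      then show False using R B' indep_mono[of "ends G" B' "insert e B"] by blast
    qed
  qed
  then show ?thesis using forest_edge_set_iff_indep[OF assms] by (auto simp: cycle_matroid_def)
qed

text \<open>An edge outside a base closes an even set with it, so its ends are already linked inside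
  the base. A base therefore connects all vertices, and \<open>connected_card_le\<close>
  applies.\<close>

lemma base_card_ge:
  assumes wf: "wf_graph G" and conn: "connected_graph G" and B: "B \<in> bases (cycle_matroid G)"
  shows "card (verts G) \<le> Suc (card B)"
proof (rule connected_card_le[where f = "ends G"])
  have sub: "B \<subseteq> edges G" using B base_iff[OF wf] by blast
  show "finite (verts G)" "finite B" "\<And>e. e \<in> B \<Longrightarrow> ends G e \<subseteq> verts G"
    using wf sub by (auto simp: wf_graph_def intro: finite_subset)
  have "adjacency G \<subseteq> (links (ends G) B)\<^sup>*"
  proof clarify
    fix u v assume "(u, v) \<in> adjacency G"
    then obtain e where e: "e \<in> edges G" "ends G e = {u, v}" by (auto simp: adjacency_def)
    show "(u, v) \<in> (links (ends G) B)\<^sup>*"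
    proof (cases "e \<in> B")
      case True
      then have "(u, v) \<in> links (ends G) B" using e by (auto simp: links_def)
      then show ?thesis by blast
    next
      case False
      then have "\<not> indep (ends G) (insert e B)" "indep (ends G) B" using B e base_iff[OF wf] by blast+
      then obtain D where D: "D \<subseteq> insert e B" "even_set (ends G) D" "e \<in> D"
        unfolding indep_def by (metis subset_insert)
      have "(u, v) \<in> (links (ends G) (D - {e}))\<^sup>*"
        using D e sub wf by (intro even_set_reconnects) (auto simp: wf_graph_def)
      moreover have "links (ends G) (D - {e}) \<subseteq> links (ends G) B" using D by (intro links_mono) auto
      ultimately show ?thesis using rtrancl_mono by blast
    qed
  qed
  then have "(adjacency G)\<^sup>* \<subseteq> (links (ends G) B)\<^sup>*" by (metis rtrancl_idemp rtrancl_mono)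
  then show "\<And>u v. u \<in> verts G \<Longrightarrow> v \<in> verts G \<Longrightarrow> (u, v) \<in> (links (ends G) B)\<^sup>*"
    using conn by (auto simp: connected_graph_def)
qed

lemma indep_extends_to_base:
  assumes wf: "wf_graph G" and I: "I \<subseteq> edges G" "indep (ends G) I"
  obtains B where "B \<in> bases (cycle_matroid G)" "I \<subseteq> B"
proof -
  let ?A = "{B. B \<subseteq> edges G \<and> indep (ends G) B}"
  have "finite ?A" using wf by (auto simp: wf_graph_def)
  then obtain B where B: "B \<in> ?A" "I \<subseteq> B" "\<forall>B'\<in>?A. B \<subseteq> B' \<longrightarrow> B = B'"
    using finite_has_maximal2[of ?A I] I by blast
  then have "B \<in> bases (cycle_matroid G)" unfolding base_iff[OF wf] by blast
  then show ?thesis using B that by blast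
qed

section \<open>What the truncation determines\<close>

lemma bases_truncation:
  "C \<in> bases (truncation M) \<longleftrightarrow> (\<exists>B y. B \<in> bases M \<and> y \<in> B \<and> C = B - {y})"
  by (auto simp: truncation_def)

text \<open>A base of \<open>G\<close> containing \<open>I\<close> is larger than \<open>I\<close>,
  so an element outside \<open>I\<close> can be deleted from it. What remains is a base of the
  common truncation and hence lies in a base of \<open>F\<close>.\<close>

lemma truncation_indep_transfer:
  assumes wf: "wf_graph G" "wf_graph F"
    and trunc: "truncation (cycle_matroid G) = truncation (cycle_matroid F)"
    and big: "\<And>B. B \<in> bases (cycle_matroid G) \<Longrightarrow> card I < card B"
    and I: "I \<subseteq> edges G" "indep (ends G) I"
  shows "indep (ends F) I"
proof -
  obtain B where B: "B \<in> bases (cycle_matroid G)" "I \<subseteq> B"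
    using indep_extends_to_base[OF wf(1) I] by blast
  then have "I \<noteq> B" using big by blast
  then obtain y where y: "y \<in> B" "y \<notin> I" using B by blast
  then have "B - {y} \<in> bases (truncation (cycle_matroid F))"
    using B bases_truncation[of _ "cycle_matroid G"] trunc by metis
  then obtain B' where "B' \<in> bases (cycle_matroid F)" "B - {y} \<subseteq> B'"
    unfolding bases_truncation by blast
  then show ?thesis using B y base_iff[OF wf(2)] indep_mono[of "ends F" B' I] by blast
qed

lemma indep_singleton: "f e \<noteq> {} \<Longrightarrow> indep f {e}"
  unfolding indep_def
proof (intro allI impI, rule ccontr)
  fix D assume "f e \<noteq> {}" and D: "D \<subseteq> {e}" "even_set f D" "D \<noteq> {}"
  then obtain v where "v \<in> f e" "e \<in> D" by blast
  then show False using even_set_another_edge[OF D(2), of e v] D(1) by blast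
qed

text \<open>Bounds the rank of \<open>F\<close> through \<open>G\<close>: deleting one element from
  a base of either graph gives the same sets, so bases of \<open>F\<close> are as large as bases of
  \<open>G\<close>.\<close>

lemma truncation_base_card_ge:
  assumes wf: "wf_graph G" "wf_graph F" and conn: "connected_graph G"
    and "edges G = edges F" "edges F \<noteq> {}"
    and trunc: "truncation (cycle_matroid G) = truncation (cycle_matroid F)"
    and B: "B \<in> bases (cycle_matroid F)"
  shows "card (verts G) \<le> Suc (card B)"
proof -
  \<comment> \<open>A one-edge set is independent, so the base \<open>B\<close> is not empty and has
    an element that can be deleted.\<close>
  obtain e where e: "e \<in> edges F" using assms(5) by blast
  then have "ends F e \<noteq> {}" using wf by (auto simp: wf_graph_def)
  then have "indep (ends F) {e}" by (rule indep_singleton)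
  then have "B \<noteq> {}" using e B base_iff[OF wf(2)] by auto
  then obtain y where y: "y \<in> B" by blast
  then have "B - {y} \<in> bases (truncation (cycle_matroid G))"
    using B bases_truncation[of _ "cycle_matroid F"] trunc by metis
  then obtain B' z where B': "B' \<in> bases (cycle_matroid G)" "z \<in> B'" "B - {y} = B' - {z}"
    unfolding bases_truncation by blast
  have "finite B" "finite B'" using B B' base_iff wf by (meson finite_subset wf_graph_def)+
  then have "card B = card B'" using B' y by (metis card.remove)
  then show ?thesis using base_card_ge[OF wf(1) conn B'(1)] by simp
qed

lemma vpath_hd_last:
  assumes "vpath f vs es"
  shows "hd vs = vs ! 0" "last vs = vs ! length es"
proof -
  have "length vs = Suc (length es)" "vs \<noteq> []" using assms by (auto simp: vpath_def)
  then show "hd vs = vs ! 0" "last vs = vs ! length es" by (simp_all add: hd_conv_nth last_conv_nth)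
qed

lemma vpath_hd_neq_last:
  assumes "vpath f vs es" "es \<noteq> []"
  shows "hd vs \<noteq> last vs"
proof -
  have "distinct vs" "length vs = Suc (length es)" using assms(1) by (auto simp: vpath_def)
  then show ?thesis using assms(2) unfolding vpath_hd_last[OF assms(1)]
    by (simp add: nth_eq_iff_index_eq)
qed

section \<open>Theta graphs\<close>

text \<open>Three paths join \<open>hd vs\<close> to \<open>last vs\<close>: the path
  \<open>es\<close>, the single edge \<open>p\<close>, and the path \<open>q\<close>,
  \<open>r\<close> through \<open>c\<close>. The list \<open>es\<close> is in path order,
  \<open>q\<close> sits at the head and \<open>r\<close> at the tail.\<close>

definition theta :: "('v, 'e) mgraph \<Rightarrow> 'v list \<Rightarrow> 'e list \<Rightarrow> 'v \<Rightarrow> 'e \<Rightarrow> 'e \<Rightarrow> 'e \<Rightarrow> bool" where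
  "theta G vs es c p q r \<longleftrightarrow> vpath (ends G) vs es \<and> c \<notin> set vs \<and> distinct (es @ [p, q, r]) \<and>
     verts G = insert c (set vs) \<and> edges G = set (es @ [p, q, r]) \<and>
     ends G p = {hd vs, last vs} \<and> ends G q = {hd vs, c} \<and> ends G r = {last vs, c}"

lemma bij_between_lists:
  assumes "distinct xs" "distinct ys" "length xs = length ys"
  obtains h where "bij_betw h (set xs) (set ys)" "map h xs = ys"
proof -
  define h where "h x = the (map_of (zip xs ys) x)" for x
  have "h (xs ! i) = ys ! i" if "i < length xs" for i
    using that assms by (simp add: h_def map_of_zip_nth)
  then have m: "map h xs = ys" using assms(3) by (simp add: list_eq_iff_nth_eq)
  then have "bij_betw h (set xs) (set ys)" using assms(1,2)
    by (metis bij_betw_def distinct_map set_map)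
  then show ?thesis using m that by blast
qed

text \<open>Vertices are matched by position and \<open>c\<close> goes to \<open>y\<close>. The edge
  labels of the two graphs may differ, so this serves both for isomorphism and for equality of
  labelled graphs.\<close>

lemma theta_vertex_bij:
  assumes G: "theta G vs es c p q r" and F: "theta F ws fs y p' q' r'"
    and len: "length es = length fs"
  obtains h where "bij_betw h (verts G) (verts F)"
    "\<forall>i<length es. ends F (fs ! i) = h ` ends G (es ! i)"
    "ends F p' = h ` ends G p" "ends F q' = h ` ends G q" "ends F r' = h ` ends G r"
proof -
  have l: "length vs = Suc (length es)" "length ws = Suc (length fs)" "vs \<noteq> []" "ws \<noteq> []"
    using G F by (auto simp: theta_def vpath_def)
  obtain h where h: "bij_betw h (set (c # vs)) (set (y # ws))" "map h (c # vs) = y # ws"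
    using bij_between_lists[of "c # vs" "y # ws"] G F l len by (auto simp: theta_def vpath_def)
  have hv: "h c = y" "h (hd vs) = hd ws" "h (last vs) = last ws" using h(2) l
    by (auto simp: hd_map last_map)
  have hi: "h (vs ! i) = ws ! i" if "i < length vs" for i
    using h(2) that by (metis list.inject list.simps(9) nth_map)
  show ?thesis
  proof (rule that[of h])
    show "bij_betw h (verts G) (verts F)" using h(1) G F by (simp add: theta_def)
    show "\<forall>i<length es. ends F (fs ! i) = h ` ends G (es ! i)"
    proof (intro allI impI)
      fix i assume that: "i < length es"
      have "ends F (fs ! i) = {ws ! i, ws ! Suc i}" "ends G (es ! i) = {vs ! i, vs ! Suc i}"
        using that len F G unfolding theta_def vpath_def by simp_all
      then show "ends F (fs ! i) = h ` ends G (es ! i)" using hi[of i] hi[of "Suc i"] that l by simp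
    qed
  qed (use G F hv in \<open>simp_all add: theta_def\<close>)
qed

lemma theta_isomorphic:
  assumes G: "theta G vs es c p q r" and F: "theta F ws fs y p' q' r'"
    and len: "length es = length fs"
  shows "isomorphic G F"
proof -
  obtain h where h: "bij_betw h (verts G) (verts F)"
    "\<forall>i<length es. ends F (fs ! i) = h ` ends G (es ! i)"
    "ends F p' = h ` ends G p" "ends F q' = h ` ends G q" "ends F r' = h ` ends G r"
    by (rule theta_vertex_bij[OF assms])
  obtain k where k: "bij_betw k (set (es @ [p, q, r])) (set (fs @ [p', q', r']))"
    "map k (es @ [p, q, r]) = fs @ [p', q', r']"
    by (rule bij_between_lists[of "es @ [p, q, r]" "fs @ [p', q', r']"])
      (use G F len in \<open>auto simp: theta_def\<close>)
  have kv: "map k es = fs" "k p = p'" "k q = q'" "k r = r'" using k(2) len by auto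
  have "ends F (k e) = h ` ends G e" if "e \<in> edges G" for e
  proof -
    have "e \<in> set es \<or> e = p \<or> e = q \<or> e = r" using that G by (auto simp: theta_def)
    moreover have "ends F (k e) = h ` ends G e" if "e \<in> set es"
      using that h(2) kv(1) by (auto simp: in_set_conv_nth)
    ultimately show ?thesis using h(3-5) kv(2-4) by (elim disjE) simp_all
  qed
  moreover have "bij_betw k (edges G) (edges F)" using k(1) G F by (simp add: theta_def)
  ultimately show ?thesis unfolding isomorphic_def using h(1) by blast
qed

lemma theta_same_up_to_vertex_names:
  assumes G: "theta G vs es c p q r" and F: "theta F ws es y p q r"
  shows "same_up_to_vertex_names G F"
proof -
  obtain h where h: "bij_betw h (verts G) (verts F)"
    "\<forall>i<length es. ends F (es ! i) = h ` ends G (es ! i)"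
    "ends F p = h ` ends G p" "ends F q = h ` ends G q" "ends F r = h ` ends G r"
    by (rule theta_vertex_bij[OF assms refl])
  have eq: "edges G = edges F" using G F by (simp add: theta_def)
  have "ends F e = h ` ends G e" if "e \<in> edges G" for e
  proof -
    have "e \<in> set es \<or> e = p \<or> e = q \<or> e = r" using that G by (auto simp: theta_def)
    moreover have "ends F e = h ` ends G e" if "e \<in> set es"
      using that h(2) by (auto simp: in_set_conv_nth)
    ultimately show ?thesis using h(3-5) by (elim disjE) simp_all
  qed
  then show ?thesis unfolding same_up_to_vertex_names_def using h(1) eq by blast
qed

section \<open>Two-connectedness from a Hamiltonian cycle\<close>

lemma connected_graph_if_reaches:
  assumes "r \<in> verts G" "\<And>v. v \<in> verts G \<Longrightarrow> (r, v) \<in> (adjacency G)\<^sup>*"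
  shows "connected_graph G"
proof -
  have "sym (adjacency G)" unfolding sym_def adjacency_def by (auto simp: insert_commute)
  then have sym: "sym ((adjacency G)\<^sup>*)" by (rule sym_rtrancl)
  have "(u, v) \<in> (adjacency G)\<^sup>*" if "u \<in> verts G" "v \<in> verts G" for u v
    using symD[OF sym assms(2)[OF that(1)]] assms(2)[OF that(2)] by (rule rtrancl_trans)
  then show ?thesis using assms(1) unfolding connected_graph_def by blast
qed

text \<open>Deleting the vertex at position \<open>k\<close> cuts the path into a front and a rear
  piece. The edge \<open>q\<close> joins them again when both are nonempty.\<close>

lemma hamiltonian_two_connected:
  assumes conn: "connected_graph G" and p: "vpath (ends G) vs es" and len: "length es \<ge> 2"
    and V: "verts G = set vs" and E: "set es \<subseteq> edges G"
    and q: "q \<in> edges G" "ends G q = {hd vs, last vs}"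
  shows "two_connected G"
  unfolding two_connected_def
proof (intro conjI ballI conn)
  have l: "length vs = Suc (length es)" "distinct vs" using p by (auto simp: vpath_def)
  then show "3 \<le> card (verts G)" using len V by (simp add: distinct_card)
  fix v assume "v \<in> verts G"
  then obtain k where k: "k < length vs" "v = vs ! k" using V by (auto simp: in_set_conv_nth)
  let ?H = "delete_vertex G v" and ?n = "length es"
  have VH: "verts ?H = set vs - {v}" using V by (simp add: delete_vertex_def)
  have nbrs: "(vs ! j, vs ! Suc j) \<in> adjacency ?H" "(vs ! Suc j, vs ! j) \<in> adjacency ?H"
    if "j < ?n" "j \<noteq> k" "Suc j \<noteq> k" for j
  proof -
    have e: "es ! j \<in> edges G" "ends G (es ! j) = {vs ! j, vs ! Suc j}"
      using that(1) p E by (auto simp: vpath_def)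
    moreover have "v \<notin> {vs ! j, vs ! Suc j}"
      using that l k by (auto simp: nth_eq_iff_index_eq)
    ultimately have "es ! j \<in> edges ?H" "ends ?H (es ! j) = {vs ! j, vs ! Suc j}"
      by (auto simp: delete_vertex_def)
    then show "(vs ! j, vs ! Suc j) \<in> adjacency ?H" "(vs ! Suc j, vs ! j) \<in> adjacency ?H"
      by (auto simp: adjacency_def insert_commute)
  qed
  have front: "(vs ! 0, vs ! j) \<in> (adjacency ?H)\<^sup>*" if "j < k" for j
    using that
  proof (induction j)
    case (Suc j)
    then show ?case using nbrs(1)[of j] k l by (auto intro: rtrancl_into_rtrancl)
  qed simp
  have rear: "(vs ! ?n, vs ! j) \<in> (adjacency ?H)\<^sup>*" if "k < j" "j \<le> ?n" for j
    using that(2,1)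
  proof (induction j rule: inc_induct)
    case (step j)
    then show ?case using nbrs(2)[of j]
      by (auto intro: rtrancl_into_rtrancl)
  qed simp
  have jump: "(vs ! ?n, vs ! 0) \<in> adjacency ?H" if "0 < k" "k < ?n"
  proof -
    have "ends G q = {vs ! 0, vs ! ?n}" using q(2) vpath_hd_last[OF p] by simp
    moreover have "v \<notin> {vs ! 0, vs ! ?n}" using that l k by (auto simp: nth_eq_iff_index_eq)
    ultimately have "q \<in> edges ?H" "ends ?H q = {vs ! ?n, vs ! 0}"
      using q(1) by (auto simp: delete_vertex_def)
    then show ?thesis by (auto simp: adjacency_def)
  qed
  have idx: "\<exists>j<length vs. w = vs ! j \<and> j \<noteq> k" if "w \<in> verts ?H" for w
    using that k unfolding VH by (auto simp: in_set_conv_nth)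
  show "connected_graph ?H"
  \<comment> \<open>Reachability is shown from the last vertex, or from the first one when the last
    is deleted.\<close>
  proof (cases "k = ?n")
    case True
    show ?thesis
    proof (rule connected_graph_if_reaches)
      show "vs ! 0 \<in> verts ?H" using True k l len unfolding VH by (auto simp: nth_eq_iff_index_eq)
      fix w assume "w \<in> verts ?H"
      then obtain j where j: "j < length vs" "w = vs ! j" "j \<noteq> k" using idx by blast
      then have "j < k" using True l by simp
      then show "(vs ! 0, w) \<in> (adjacency ?H)\<^sup>*" using front j by blast
    qed
  next
    case False
    then have kn: "k < ?n" using k l by simp
    show ?thesis
    proof (rule connected_graph_if_reaches)
      show "vs ! ?n \<in> verts ?H" using kn k l unfolding VH by (auto simp: nth_eq_iff_index_eq)
      fix w assume "w \<in> verts ?H"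
      then obtain j where j: "j < length vs" "w = vs ! j" "j \<noteq> k" using idx by blast
      show "(vs ! ?n, w) \<in> (adjacency ?H)\<^sup>*"
      proof (cases "j < k")
        case True
        then show ?thesis using jump kn front j
          by (metis converse_rtrancl_into_rtrancl gr_zeroI not_less_zero)
      next
        case False
        then show ?thesis using rear[of j] j l by simp
      qed
    qed
  qed
qed

text \<open>The Hamiltonian cycle consists of \<open>es\<close>, \<open>r\<close> and
  \<open>q\<close>; the edge \<open>p\<close> is a chord of it.\<close>

lemma theta_two_connected:
  assumes "connected_graph G" and t: "theta G vs es c p q r" and "es \<noteq> []"
  shows "two_connected G"
proof (rule hamiltonian_two_connected[OF assms(1)])
  have ne: "vs \<noteq> []" using t by (auto simp: theta_def vpath_def)
  show "vpath (ends G) (vs @ [c]) (es @ [r])" using t by (intro vpath_snoc) (auto simp: theta_def)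
  show "verts G = set (vs @ [c])" "set (es @ [r]) \<subseteq> edges G" "q \<in> edges G"
    using t by (auto simp: theta_def)
  show "2 \<le> length (es @ [r])" using assms(3) by (simp add: Suc_le_eq)
  show "ends G q = {hd (vs @ [c]), last (vs @ [c])}" using t ne by (simp add: theta_def)
qed

section \<open>Whitney switches\<close>

text \<open>The part to be twisted consists of the two edges at \<open>m\<close>. It meets the rest
  in \<open>u\<close> and \<open>v\<close>, and transposing these while \<open>m\<close> stays fixed
  interchanges the end-pairs of \<open>e1\<close> and \<open>e2\<close>.\<close>

lemma whitney_switch_at_degree_2:
  assumes wf: "wf_graph G" and d: "{e \<in> edges G. m \<in> ends G e} = {e1, e2}" "e1 \<noteq> e2"
    and e: "ends G e1 = {u, m}" "ends G e2 = {m, v}" and uv: "u \<noteq> v"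
  shows "whitney_switch G (exchange_edges e1 e2 G)"
proof -
  define A where "A = \<lparr>verts = {u, m, v}, edges = {e1, e2}, ends = ends G\<rparr>"
  define B where "B = \<lparr>verts = verts G - {m}, edges = edges G - {e1, e2}, ends = ends G\<rparr>"
  have in_E: "e1 \<in> edges G" "e2 \<in> edges G" using d(1) by blast+
  then have in_V: "{u, m} \<subseteq> verts G" "{m, v} \<subseteq> verts G" and two: "card {u, m} = 2" "card {m, v} = 2"
    using wf e unfolding wf_graph_def by metis+
  then have mu: "m \<noteq> u" "m \<noteq> v" by auto
  have "subgraph A G" using in_E in_V two e by (auto simp: subgraph_def A_def wf_graph_def)
  moreover have "m \<notin> ends G e" if "e \<in> edges G - {e1, e2}" for e using d(1) that by blast
  then have "subgraph B G" using wf by (auto simp: subgraph_def B_def wf_graph_def)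
  moreover have "verts A \<union> verts B = verts G" "verts A \<inter> verts B = {u, v}"
    using in_V mu by (auto simp: A_def B_def)
  moreover have "edges A \<union> edges B = edges G" "edges A \<inter> edges B = {}"
    using in_E by (auto simp: A_def B_def)
  moreover have "exchange_edges e1 e2 G =
      G\<lparr>ends := \<lambda>e. if e \<in> edges A then transpose u v ` ends G e else ends G e\<rparr>"
  proof -
    have t: "transpose u v u = v" "transpose u v v = u" "transpose u v m = m"
      using mu by (simp_all add: transpose_def)
    have "(ends G)(e1 := ends G e2, e2 := ends G e1) =
        (\<lambda>e. if e \<in> edges A then transpose u v ` ends G e else ends G e)"
      using e d(2) t by (auto simp: A_def fun_eq_iff insert_commute)
    then show ?thesis by (simp add: exchange_edges_def)
  qed
  ultimately show ?thesis unfolding whitney_switch_def using uv by blast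
qed

text \<open>Supplies well-formedness for the intermediate graphs of a series of switches. With
  \<open>es = []\<close> the edge \<open>p\<close> would be a loop.\<close>

lemma theta_wf:
  assumes t: "theta G vs es c p q r" and len: "es \<noteq> []"
  shows "wf_graph G"
proof -
  have p: "vpath (ends G) vs es" and l: "length vs = Suc (length es)" "distinct vs"
    using t by (auto simp: theta_def vpath_def)
  then have hl: "hd vs \<noteq> last vs" "hd vs \<in> set vs" "last vs \<in> set vs"
    using vpath_hd_neq_last[OF p len] vpath_nonempty[OF p] by simp_all
  have "ends G e \<subseteq> verts G \<and> card (ends G e) = 2" if "e \<in> edges G" for e
  proof -
    have "e \<in> set es \<or> e = p \<or> e = q \<or> e = r" using that t by (auto simp: theta_def)
    moreover have "ends G e \<subseteq> verts G \<and> card (ends G e) = 2" if "e \<in> set es"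
    proof -
      obtain i where i: "i < length es" "e = es ! i" using \<open>e \<in> set es\<close> by (auto simp: in_set_conv_nth)
      then have "ends G e = {vs ! i, vs ! Suc i}" using p by (simp add: vpath_def)
      moreover have "vs ! i \<noteq> vs ! Suc i" "vs ! i \<in> set vs" "vs ! Suc i \<in> set vs"
        using i l by (simp_all add: nth_eq_iff_index_eq)
      ultimately show ?thesis using t by (simp add: theta_def)
    qed
    moreover have "c \<noteq> hd vs" "c \<noteq> last vs" using hl t by (auto simp: theta_def)
    ultimately show ?thesis using t hl by (auto simp: theta_def)
  qed
  then show ?thesis using t by (auto simp: wf_graph_def theta_def)
qed

text \<open>The vertex between two consecutive edges of the long path is not an end of
  \<open>p\<close>, \<open>q\<close> or \<open>r\<close>, so it has degree 2.\<close>

lemma theta_switch_adjacent: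
  assumes t: "theta G vs (as @ e1 # e2 # bs) c p q r"
  shows "whitney_switch G (exchange_edges e1 e2 G) \<and>
    theta (exchange_edges e1 e2 G) vs (as @ e2 # e1 # bs) c p q r"
proof -
  let ?es = "as @ e1 # e2 # bs" and ?k = "length as"
  let ?fs = "as @ e2 # e1 # bs" and ?H = "exchange_edges e1 e2 G"
  have pth: "vpath (ends G) vs ?es" and l: "length vs = Suc (length ?es)" "distinct vs"
    and d: "distinct (?es @ [p, q, r])"
    using t by (auto simp: theta_def vpath_def)
  have nths: "?es ! ?k = e1" "?es ! Suc ?k = e2" by (simp_all add: nth_append)
  have ends: "ends G (?es ! i) = {vs ! i, vs ! Suc i}" if "i < length ?es" for i
    using pth that unfolding vpath_def by blast
  have e1: "ends G e1 = {vs ! ?k, vs ! Suc ?k}" using ends[of ?k] nths by simp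
  have e2: "ends G e2 = {vs ! Suc ?k, vs ! Suc (Suc ?k)}" using ends[of "Suc ?k"] nths by simp
  have m: "vs ! Suc ?k \<noteq> hd vs" "vs ! Suc ?k \<noteq> last vs" "vs ! Suc ?k \<in> set vs"
    using l vpath_hd_last[OF pth] by (simp_all add: nth_eq_iff_index_eq)
  have "{e \<in> set ?es. vs ! Suc ?k \<in> ends G e} =
      (\<lambda>j. ?es ! j) ` {j. j < length ?es \<and> (j = Suc ?k \<or> Suc j = Suc ?k)}"
    using l by (intro vpath_incident[OF pth]) simp
  also have "{j. j < length ?es \<and> (j = Suc ?k \<or> Suc j = Suc ?k)} = {?k, Suc ?k}" by auto
  finally have "{e \<in> set ?es. vs ! Suc ?k \<in> ends G e} = {e1, e2}" using nths by simp
  moreover have "vs ! Suc ?k \<notin> ends G p" "vs ! Suc ?k \<notin> ends G q" "vs ! Suc ?k \<notin> ends G r"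
    using m t by (auto simp: theta_def)
  moreover have "edges G = set ?es \<union> {p, q, r}" using t unfolding theta_def by auto
  ultimately have "{e \<in> edges G. vs ! Suc ?k \<in> ends G e} = {e1, e2}" by blast
  moreover have "vs ! ?k \<noteq> vs ! Suc (Suc ?k)" using l by (simp add: nth_eq_iff_index_eq)
  ultimately have switch: "whitney_switch G ?H"
    using d e1 e2 theta_wf[OF t] by (intro whitney_switch_at_degree_2) auto
  \<comment> \<open>The edge now at position \<open>i\<close> has the ends of the edge formerly
    there, so the vertex list \<open>vs\<close> still fits.\<close>
  have "ends ?H (?fs ! i) = ends G (?es ! i)" if "i < length ?es" for i
  proof -
    consider "i = ?k" | "i = Suc ?k" | "i \<noteq> ?k" "i \<noteq> Suc ?k" by blast
    then show ?thesis
    proof cases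
      case 3
      have "?es ! i \<noteq> ?es ! ?k" "?es ! i \<noteq> ?es ! Suc ?k"
        using d 3 that by (subst nth_eq_iff_index_eq; simp)+
      then have "?es ! i \<noteq> e1" "?es ! i \<noteq> e2" using nths by simp_all
      moreover have "?fs ! i = ?es ! i" using 3 by (auto simp: nth_append nth_Cons')
      ultimately show ?thesis by (simp add: exchange_edges_def)
    qed (use d in \<open>auto simp: exchange_edges_def nth_append\<close>)
  qed
  then have "vpath (ends ?H) vs ?fs" using pth unfolding vpath_def by simp
  moreover have "ends ?H e = ends G e" if "e \<in> {p, q, r}" for e
    using d that by (auto simp: exchange_edges_def)
  ultimately have "theta ?H vs ?fs c p q r" using t
    by (auto simp: theta_def exchange_edges_def)
  then show ?thesis using switch by blast
qed

section \<open>Reordering the long path by adjacent swaps\<close>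

inductive adjacent_swap :: "'a list \<Rightarrow> 'a list \<Rightarrow> bool" where
  "adjacent_swap (as @ a # b # bs) (as @ b # a # bs)"

lemma adjacent_swaps_Cons:
  assumes "adjacent_swap\<^sup>*\<^sup>* xs ys"
  shows "adjacent_swap\<^sup>*\<^sup>* (x # xs) (x # ys)"
  using assms
proof (induction rule: rtranclp_induct)
  case (step ys zs)
  have "adjacent_swap (x # ys) (x # zs)" using step(2)
    by (metis adjacent_swap.cases adjacent_swap.intros append_Cons)
  then show ?case using step(3) by simp
qed simp

lemma adjacent_swaps_front: "adjacent_swap\<^sup>*\<^sup>* (as @ x # bs) (x # as @ bs)"
proof (induction as)
  case (Cons a as)
  have "adjacent_swap\<^sup>*\<^sup>* (a # as @ x # bs) (a # x # as @ bs)"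
    using Cons by (rule adjacent_swaps_Cons)
  moreover have "adjacent_swap (a # x # as @ bs) (x # a # as @ bs)"
    using adjacent_swap.intros[of "[]"] by simp
  ultimately show ?case by simp
qed simp

text \<open>The first element of the target is moved to the front; the remaining elements are sorted
  behind it by induction.\<close>

lemma permuted_adjacent_swaps:
  assumes "distinct xs" "distinct ys" "set xs = set ys"
  shows "adjacent_swap\<^sup>*\<^sup>* xs ys"
  using assms
proof (induction ys arbitrary: xs)
  case (Cons y ys)
  then obtain as bs where xs: "xs = as @ y # bs" by (metis list.set_intros(1) split_list)
  have "adjacent_swap\<^sup>*\<^sup>* (as @ bs) ys" using Cons.prems xs by (intro Cons.IH) auto
  then have "adjacent_swap\<^sup>*\<^sup>* (y # as @ bs) (y # ys)" by (rule adjacent_swaps_Cons)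
  then show ?case unfolding xs using adjacent_swaps_front by (metis rtranclp_trans)
qed simp

lemma theta_switches_permute:
  assumes t: "theta G vs es c p q r" and fs: "distinct fs" "set fs = set es"
  obtains H where "whitney_switch\<^sup>*\<^sup>* G H" "theta H vs fs c p q r"
proof -
  have "adjacent_swap\<^sup>*\<^sup>* es fs"
    using t fs by (intro permuted_adjacent_swaps) (auto simp: theta_def)
  then have "\<exists>H. whitney_switch\<^sup>*\<^sup>* G H \<and> theta H vs fs c p q r"
  proof (induction rule: rtranclp_induct)
    case base
    then show ?case using t by blast
  next
    case (step es fs)
    then obtain H where H: "whitney_switch\<^sup>*\<^sup>* G H" "theta H vs es c p q r" by blast
    from step(2) show ?case
    proof cases
      case (1 as a b bs)
      then show ?thesis using H theta_switch_adjacent[of H vs as a b bs c p q r]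
        by (meson rtranclp.rtrancl_into_rtrancl)
    qed
  qed
  then show ?thesis using that by blast
qed

lemma theta_exchange:
  assumes t: "theta G vs es c p q r"
  shows "theta (exchange_edges p r G) vs es c r q p"
proof -
  have "ends (exchange_edges p r G) e = ends G e" if "e \<in> set es" for e
    using t that by (auto simp: theta_def exchange_edges_def)
  then have "vpath (ends (exchange_edges p r G)) vs es"
    using t by (simp add: theta_def vpath_def)
  then show ?thesis using t by (auto simp: theta_def exchange_edges_def insert_commute)
qed

section \<open>Cycles as closed paths, triangles, and \<open>K4\<close> minus an edge\<close>

lemma cycle_closed_vpath:
  assumes C: "is_cycle C" and x: "x \<in> edges C" "ends C x = {a, b}"
  obtains vs es where "vpath (ends C) vs es" "hd vs = a" "last vs = b" "es \<noteq> []"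
    "set es = edges C - {x}" "set vs = verts C"
proof -
  let ?f = "ends C"
  have wf: "wf_graph C" and conn: "connected_graph C" and fin: "finite (edges C)"
    and deg: "\<And>v. v \<in> verts C \<Longrightarrow> card {e \<in> edges C. v \<in> ?f e} = 2"
    using C by (auto simp: is_cycle_def wf_graph_def degree_def)
  have two: "card (?f e) = 2" "?f e \<subseteq> verts C" if "e \<in> edges C" for e
    using wf that by (simp_all add: wf_graph_def)
  have ev: "even_set ?f (edges C)" using C by (rule cycle_even_set) simp
  have ab: "a \<noteq> b" using two(1)[OF x(1)] x(2) by auto
  have ln: "(a, b) \<in> (links ?f (edges C - {x}))\<^sup>*"
    using ev x two(1) by (rule even_set_reconnects)
  have nx: "x \<notin> edges C - {x}" by simp
  obtain vs es where p: "vpath ?f vs es" "set es \<subseteq> edges C - {x}" "hd vs = a" "last vs = b"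
    "es \<noteq> []" "even_set ?f (insert x (set es))"
    by (rule linked_even_set[where f = ?f and x = x and A = "edges C - {x}", OF nx x(2) ab ln])
  let ?Y = "insert x (set es)"
  have YC: "?Y \<subseteq> edges C" and nxe: "x \<notin> set es" using p(2) x(1) by blast+
  have xe: "?f x = {hd vs, last vs}" using p x by simp
  have fY: "?f e \<subseteq> set vs" if "e \<in> ?Y" for e
    using that vpath_vertices[OF p(1,5)] vpath_nonempty[OF p(1)] xe by auto
  have in_C: "set vs \<subseteq> verts C" using vpath_vertices[OF p(1,5)] two(2) p(2) by blast
  \<comment> \<open>The closed path already uses two edges at each of its vertices, and in
    \<open>C\<close> there are only two. By connectedness the path then fills all of
    \<open>C\<close>.\<close>
  have Y: "e \<in> ?Y" if "v \<in> set vs" "e \<in> edges C" "v \<in> ?f e" for e v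
  proof -
    have "{e \<in> ?Y. v \<in> ?f e} \<subseteq> {e \<in> edges C. v \<in> ?f e}" using YC by blast
    moreover have "card {e \<in> ?Y. v \<in> ?f e} = card {e \<in> edges C. v \<in> ?f e}"
      using closed_vpath_degree[OF p(1,5) nxe xe, of v] deg[of v] that(1) in_C by auto
    ultimately have "{e \<in> ?Y. v \<in> ?f e} = {e \<in> edges C. v \<in> ?f e}"
      using fin by (intro card_subset_eq) auto
    then show ?thesis using that by blast
  qed
  have a: "a \<in> set vs" using p(3) vpath_nonempty[OF p(1)] by auto
  have "v \<in> set vs" if "v \<in> verts C" for v
  proof -
    have "(a, v) \<in> (adjacency C)\<^sup>*" using conn a in_C that by (auto simp: connected_graph_def)
    then show ?thesis
    proof (induction rule: rtrancl_induct)
      case (step u w)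
      then obtain e where "e \<in> edges C" "?f e = {u, w}" by (auto simp: adjacency_def)
      then show ?case using Y[of u e] fY[of e] step.IH by auto
    qed (rule a)
  qed
  then have V: "set vs = verts C" using in_C by blast
  have "edges C \<subseteq> ?Y"
  proof
    fix e assume e: "e \<in> edges C"
    then have "?f e \<noteq> {}" using two(1)[OF e] by auto
    then show "e \<in> ?Y" using Y e two(2)[OF e] V by blast
  qed
  then have "set es = edges C - {x}" using YC nxe by blast
  then show ?thesis using p V that by blast
qed

lemma even_set_triangle:
  assumes ev: "even_set f {e1, e2, e3}" and inj: "inj_on f {e1, e2, e3}"
    and dist: "e1 \<noteq> e2" "e1 \<noteq> e3" "e2 \<noteq> e3"
    and two: "\<And>e. e \<in> {e1, e2, e3} \<Longrightarrow> card (f e) = 2"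
  obtains a b y where "f e1 = {a, b}" "f e2 = {a, y}" "f e3 = {b, y}" "a \<noteq> b" "a \<noteq> y" "b \<noteq> y"
proof -
  \<comment> \<open>Stated for both orders of the other two edges, since either of them may be the
    one that meets \<open>e1\<close> in \<open>a\<close>.\<close>
  have third: "\<exists>y. f e' = {a, y} \<and> f e'' = {b, y} \<and> y \<noteq> a \<and> y \<noteq> b"
    if e: "{e1, e', e''} = {e1, e2, e3}" "e' \<noteq> e1" "e' \<noteq> e''" "a \<in> f e'" "f e1 = {a, b}" "a \<noteq> b"
    for e' e'' a b
  proof -
    have ev': "even_set f {e1, e', e''}" using ev e(1) by simp
    have ne: "f e' \<noteq> f e1" using inj_onD[OF inj, of e' e1] e by blast
    have "card (f e') = 2" using e(1) two by blast
    then obtain y where y: "f e' = {a, y}" "y \<noteq> a"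
      using e(4) unfolding card_2_iff by (metis insertE insert_commute singletonD)
    then have yb: "y \<noteq> b" using ne e(5) by auto
    obtain g where "g \<in> {e1, e', e''}" "g \<noteq> e1" "b \<in> f g"
      by (rule even_set_another_edge[OF ev', of e1 b]) (simp_all add: e(5))
    then have "b \<in> f e''" using y(1) yb e(6) by auto
    moreover obtain h where "h \<in> {e1, e', e''}" "h \<noteq> e'" "y \<in> f h"
      by (rule even_set_another_edge[OF ev', of e' y]) (simp_all add: y(1))
    then have "y \<in> f e''" using y(2) yb e(5) by auto
    moreover have "card (f e'') = 2" using e(1) two by blast
    ultimately have "f e'' = {b, y}" using yb by (auto simp: card_2_iff)
    then show ?thesis using y yb by blast
  qed
  have "card (f e1) = 2" using two by blast
  then obtain a b where ab: "f e1 = {a, b}" "a \<noteq> b" by (meson card_2_iff)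
  obtain e' where "e' \<in> {e1, e2, e3}" "e' \<noteq> e1" "a \<in> f e'"
    by (rule even_set_another_edge[OF ev, of e1 a]) (use ab in auto)
  then consider "a \<in> f e2" | "a \<in> f e3" by blast
  then show ?thesis
  proof cases
    case 1
    obtain y where "f e2 = {a, y}" "f e3 = {b, y}" "y \<noteq> a" "y \<noteq> b"
      using third[of e2 e3 a b] 1 ab dist by blast
    then show ?thesis using that ab by blast
  next
    case 2
    obtain y where "f e3 = {a, y}" "f e2 = {b, y}" "y \<noteq> a" "y \<noteq> b"
      using third[of e3 e2 a b] 2 ab dist by (metis insert_commute)
    \<comment> \<open>The names \<open>a\<close> and \<open>b\<close> are interchanged to fit the
      fixed order in the conclusion.\<close>
    moreover have "f e1 = {b, a}" using ab by (simp add: insert_commute)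
    ultimately show ?thesis using that[of b a y] ab by blast
  qed
qed

text \<open>Five of the six vertex pairs carry an edge, so exactly one pair \<open>{a, b}\<close> is
  missing.\<close>

lemma simple_graph_4_5_theta:
  assumes simple: "simple_graph F" and V: "card (verts F) = 4" and E: "card (edges F) = 5"
  obtains ws fs y p q r where "theta F ws fs y p q r" "length fs = 2"
proof -
  have wf: "wf_graph F" using simple by (simp add: simple_graph_def)
  have fin: "finite (verts F)" "finite (edges F)" using wf by (simp_all add: wf_graph_def)
  have inj: "inj_on (ends F) (edges F)" using simple by (auto simp: simple_graph_def inj_on_def)
  let ?P = "{A. A \<subseteq> verts F \<and> card A = 2}"
  have finP: "finite ?P" using fin by simp
  have "card ?P = 6" using n_subsets[OF fin(1), of 2] V by (simp add: choose_two)
  moreover have "ends F ` edges F \<subseteq> ?P" using wf by (auto simp: wf_graph_def)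
  moreover have "card (ends F ` edges F) = 5" using inj E by (simp add: card_image)
  ultimately have "card (?P - ends F ` edges F) = 1" using fin by (simp add: card_Diff_subset)
  then obtain A where A: "?P - ends F ` edges F = {A}" by (rule card_1_singletonE)
  then have "A \<in> ?P" by blast
  then obtain a b where ab: "A = {a, b}" "a \<noteq> b" "a \<in> verts F" "b \<in> verts F"
    by (auto simp: card_2_iff)
  have "card (verts F - {a, b}) = 2" using ab V fin by (simp add: card_Diff_subset)
  then obtain u w where uw: "verts F - {a, b} = {u, w}" "u \<noteq> w" by (meson card_2_iff)
  then have dist: "u \<noteq> a" "u \<noteq> b" "w \<noteq> a" "w \<noteq> b" and uwV: "u \<in> verts F" "w \<in> verts F" by blast+
  have edge: "\<exists>e\<in>edges F. ends F e = {i, j}"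
    if "i \<in> verts F" "j \<in> verts F" "i \<noteq> j" "{i, j} \<noteq> {a, b}" for i j
  proof -
    have "{i, j} \<in> ?P" using that by simp
    moreover have "{i, j} \<notin> ?P - ends F ` edges F" unfolding A ab(1) using that(4) by simp
    ultimately have "{i, j} \<in> ends F ` edges F" unfolding Diff_iff by satx
    then show ?thesis by (auto simp: image_iff)
  qed
  obtain e1 where e1: "e1 \<in> edges F" "ends F e1 = {u, a}" using edge[of u a] uwV ab dist by blast
  obtain e2 where e2: "e2 \<in> edges F" "ends F e2 = {a, w}" using edge[of a w] uwV ab dist by blast
  obtain p where p: "p \<in> edges F" "ends F p = {u, w}" using edge[of u w] uwV uw dist by blast
  obtain q where q: "q \<in> edges F" "ends F q = {u, b}" using edge[of u b] uwV ab dist by blast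
  obtain r where r: "r \<in> edges F" "ends F r = {w, b}" using edge[of w b] uwV ab dist by blast
  have d: "distinct [e1, e2, p, q, r]"
    using e1(2) e2(2) p(2) q(2) r(2) dist uw(2) ab(2) by (auto simp: doubleton_eq_iff)
  have "card (set [e1, e2, p, q, r]) = 5" using distinct_card[OF d] by simp
  then have "set [e1, e2, p, q, r] = edges F"
    using e1 e2 p q r E fin by (intro card_subset_eq) auto
  moreover have "verts F = {u, a, w, b}" using uw(1) ab by blast
  moreover have "vpath (ends F) [u, a, w] [e1, e2]"
    using e1 e2 dist uw(2) by (auto simp: vpath_def less_Suc_eq)
  \<comment> \<open>The two nonadjacent vertices are the inner vertices of the two paths of length
    two from \<open>u\<close> to \<open>w\<close>; the direct edge is \<open>p\<close>.\<close>
  ultimately have "theta F [u, a, w] [e1, e2] b p q r"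
    using d p q r dist ab(2) by (auto simp: theta_def)
  then show ?thesis using that by simp
qed

section \<open>The pair of graphs\<close>

text \<open>The assumptions are symmetric in the indices 1 and 2, which \<open>swap_spokes\<close>
  exploits.\<close>

locale cycle_tree_pair =
  fixes G :: "('v, 'e) mgraph" and F :: "('w, 'e) mgraph"
    and X :: "'e set" and c r1 r2 :: 'v and s1 s2 x :: 'e
  assumes simple: "simple_graph G" "simple_graph F"
    and conn: "connected_graph G" "connected_graph F"
    and edges_eq: "edges G = edges F"
    and trunc: "truncation (cycle_matroid G) = truncation (cycle_matroid F)"
    and X_sub: "X \<subseteq> edges G"
    and cycle: "is_cycle (edge_induced G X)"
    and verts_cycle: "verts G = insert c (verts (edge_induced G X))"
    and tree: "spanning_tree (edge_induced F X) F"
    and c: "c \<notin> verts (edge_induced G X)"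
    and spokes: "{e \<in> edges G. c \<in> ends G e} = {s1, s2}" "s1 \<noteq> s2"
    and ends: "ends G s1 = {c, r1}" "ends G s2 = {c, r2}" "ends G x = {r1, r2}"
    and x: "x \<in> X"
begin

lemma wf: "wf_graph G" "wf_graph F"
  using simple by (simp_all add: simple_graph_def)

lemma finX: "finite X"
  using X_sub wf(1) unfolding wf_graph_def by (meson finite_subset)

lemma two: "e \<in> edges G \<Longrightarrow> card (ends G e) = 2" "e \<in> edges G \<Longrightarrow> card (ends F e) = 2"
  using wf edges_eq by (simp_all add: wf_graph_def)

lemma inj: "inj_on (ends G) (edges G)" "inj_on (ends F) (edges G)"
  using simple edges_eq by (auto simp: simple_graph_def inj_on_def)

lemma even_ge_3:
  assumes "D \<subseteq> edges G" "D \<noteq> {}"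
  shows "even_set (ends G) D \<Longrightarrow> 3 \<le> card D" "even_set (ends F) D \<Longrightarrow> 3 \<le> card D"
proof -
  have "inj_on (ends G) D" "inj_on (ends F) D" using inj assms(1) by (meson inj_on_subset)+
  then show "even_set (ends G) D \<Longrightarrow> 3 \<le> card D" "even_set (ends F) D \<Longrightarrow> 3 \<le> card D"
    using assms two even_set_card_ge_3 by (metis subsetD)+
qed

lemma cycle_even: "even_set (ends G) X"
  using cycle_even_set(1)[OF cycle, of "ends G"] by (simp add: edge_induced_def)

lemma spokes_edges: "s1 \<in> edges G" "s2 \<in> edges G"
  using spokes by blast+

lemma spokes_not_in_X: "s1 \<notin> X" "s2 \<notin> X"
  using c ends by (auto simp: edge_induced_def)

lemma incident_c: "e \<in> edges G \<Longrightarrow> c \<in> ends G e \<Longrightarrow> e = s1 \<or> e = s2"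
  using spokes(1) by blast

lemma r_distinct: "r1 \<noteq> r2" "c \<noteq> r1" "c \<noteq> r2"
  using two(1)[of x] two(1)[of s1] two(1)[of s2] ends x X_sub spokes_edges by auto

lemma cycle_path:
  obtains vs es where "vpath (ends G) vs es" "hd vs = r1" "last vs = r2" "es \<noteq> []"
    "set es = X - {x}" "verts G = insert c (set vs)" "c \<notin> set vs" "length vs = card X"
proof -
  obtain vs es where p: "vpath (ends G) vs es" "hd vs = r1" "last vs = r2" "es \<noteq> []"
    "set es = X - {x}" "set vs = verts (edge_induced G X)"
    using cycle_closed_vpath[OF cycle, of x r1 r2] x ends by (auto simp: edge_induced_def)
  have "length vs = Suc (length es)" using p(1) by (simp add: vpath_def)
  also have "length es = card (X - {x})"
    using distinct_card[OF vpath_distinct_edges[OF p(1)]] p(5) by simp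
  also have "Suc (card (X - {x})) = card X" using finX x by (rule card_Suc_Diff1)
  finally show ?thesis using that[OF p(1-5)] p(6) verts_cycle c by simp
qed

lemma card_verts: "card (verts G) = Suc (card X)"
proof -
  obtain vs es where p: "vpath (ends G) vs es" "hd vs = r1" "last vs = r2" "es \<noteq> []"
    "set es = X - {x}" "verts G = insert c (set vs)" "c \<notin> set vs" "length vs = card X"
    by (rule cycle_path)
  then show ?thesis using distinct_card[of vs] by (simp add: vpath_def)
qed

text \<open>All bases of \<open>G\<close> and of \<open>F\<close> have at least
  \<open>card X\<close> elements, so a smaller set never exhausts a base containing it.\<close>

lemma indep_transfer:
  assumes "I \<subseteq> edges G" "card I < card X"
  shows "indep (ends G) I \<longleftrightarrow> indep (ends F) I"
proof
  have "card I < card B" if "B \<in> bases (cycle_matroid G)" for B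
    using base_card_ge[OF wf(1) conn(1) that] assms(2) card_verts by simp
  then show "indep (ends G) I \<Longrightarrow> indep (ends F) I"
    using truncation_indep_transfer[OF wf trunc] assms(1) by blast
  have "edges F \<noteq> {}" using x X_sub edges_eq by blast
  then have "card I < card B" if "B \<in> bases (cycle_matroid F)" for B
    using truncation_base_card_ge[OF wf conn(1) edges_eq _ trunc that] assms(2) card_verts by simp
  then show "indep (ends F) I \<Longrightarrow> indep (ends G) I"
    using truncation_indep_transfer[OF wf(2,1) trunc[symmetric]] assms(1) edges_eq by blast
qed

lemma tree_indep: "indep (ends F) X"
proof -
  have "forest_edge_set F X" using tree X_sub edges_eq
    by (simp add: spanning_tree_def forest_edge_set_def)
  then show ?thesis using forest_edge_set_iff_indep[OF wf(2)] by blast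
qed

lemma tree_verts: "verts F = (\<Union>e\<in>X. ends F e)"
  using tree by (simp add: spanning_tree_def edge_induced_def)

lemma tree_linked: "u \<in> verts F \<Longrightarrow> v \<in> verts F \<Longrightarrow> (u, v) \<in> (links (ends F) X)\<^sup>*"
proof -
  let ?T = "edge_induced F X"
  have "connected_graph ?T" "verts ?T = verts F" using tree by (simp_all add: spanning_tree_def)
  moreover have "adjacency ?T = links (ends F) X"
    by (simp add: adjacency_def links_def edge_induced_def)
  ultimately show "u \<in> verts F \<Longrightarrow> v \<in> verts F \<Longrightarrow> (u, v) \<in> (links (ends F) X)\<^sup>*"
    by (simp add: connected_graph_def)
qed

text \<open>Only dependence carries over, not evenness; in \<open>F\<close> the even set may be a
  proper subset of \<open>D\<close>.\<close>

lemma even_transfer: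
  assumes "D \<subseteq> edges G" "card D < card X" "D \<noteq> {}" "even_set (ends G) D"
  obtains D' where "D' \<subseteq> D" "D' \<noteq> {}" "even_set (ends F) D'"
proof -
  have "\<not> indep (ends G) D" using assms(3,4) by (auto simp: indep_def)
  then have "\<not> indep (ends F) D" using indep_transfer[OF assms(1,2)] by simp
  then show ?thesis using that by (auto simp: indep_def)
qed

text \<open>A chord would split the cycle into two short cycles of \<open>G\<close>, which are dependent in \<open>F\<close>
  as well; there they would add up to a dependency inside the tree.\<close>

lemma edges_G: "edges G = insert s1 (insert s2 X)"
proof (rule ccontr)
  assume "edges G \<noteq> insert s1 (insert s2 X)"
  then obtain d where d: "d \<in> edges G" "d \<notin> X" "d \<noteq> s1" "d \<noteq> s2"
    using X_sub spokes_edges by blast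
  obtain vs es where p: "vpath (ends G) vs es" "hd vs = r1" "last vs = r2" "es \<noteq> []"
    "set es = X - {x}" "verts G = insert c (set vs)" "c \<notin> set vs" "length vs = card X"
    by (rule cycle_path)
  have "c \<notin> ends G d" using incident_c d by blast
  moreover have "ends G d \<subseteq> verts G" using d(1) wf(1) unfolding wf_graph_def by blast
  ultimately have sub: "ends G d \<subseteq> set vs" unfolding p(6) by (rule subset_insert[THEN iffD1])
  obtain u v where uv: "ends G d = {u, v}" "u \<noteq> v" using two(1)[OF d(1)] by (meson card_2_iff)
  obtain k l where kl: "k < length vs" "l < length vs" "u = vs ! k" "v = vs ! l" "k \<noteq> l"
    using sub uv by (auto simp: in_set_conv_nth)
  obtain i j where ij: "i < j" "j < length vs" "ends G d = {vs ! i, vs ! j}"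
  proof (cases "k < l")
    case True
    then show ?thesis using that[of k l] kl uv by simp
  next
    case False
    then show ?thesis using that[of l k] kl uv by (simp add: insert_commute)
  qed
  \<comment> \<open>The arc of the path between the two ends of \<open>d\<close>.\<close>
  define us where "us = drop i (take (Suc j) vs)"
  define gs where "gs = drop i (take j es)"
  have len: "length vs = Suc (length es)" using p(1) by (simp add: vpath_def)
  have us: "vpath (ends G) us gs" unfolding us_def gs_def
    using vpath_drop[OF vpath_take[OF p(1) ij(2)], of i] ij by simp
  have gsX: "set gs \<subseteq> X" using p(5) unfolding gs_def
    by (auto dest!: in_set_dropD in_set_takeD)
  have gs_ne: "gs \<noteq> []" using ij len by (simp add: gs_def)
  have "hd us = vs ! i" "last us = vs ! j" using ij unfolding us_def
    by (simp_all add: hd_drop_conv_nth last_conv_nth)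
  then have "ends G d = {hd us, last us}" using ij(3) by simp
  then have ev1: "even_set (ends G) (insert d (set gs))"
    using us gs_ne d(2) gsX by (intro closed_vpath_even) auto
  \<comment> \<open>Adding the whole cycle replaces the arc by its complement in
    \<open>X\<close>.\<close>
  moreover have "sym_diff (insert d (set gs)) X = insert d (X - set gs)" using d(2) gsX by blast
  ultimately have ev2: "even_set (ends G) (insert d (X - set gs))"
    using even_set_sym_diff[OF _ cycle_even] by metis
  have card1: "card (insert d (set gs)) = Suc (card (set gs))" using d(2) gsX by (subst card_insert_disjoint) auto
  have card2: "card (insert d (X - set gs)) = Suc (card X - card (set gs))"
    using d(2) finX gsX by (simp add: card_Diff_subset)
  have subE: "insert d (set gs) \<subseteq> edges G" "insert d (X - set gs) \<subseteq> edges G" using d gsX X_sub by blast+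
  \<comment> \<open>As \<open>G\<close> is simple, both arcs have at least two edges; each of the
    two even sets thus omits at least two edges of \<open>X\<close> and gains only
    \<open>d\<close>.\<close>
  have "2 \<le> card (set gs)" "2 \<le> card X - card (set gs)"
    using even_ge_3(1)[OF subE(1) _ ev1] even_ge_3(1)[OF subE(2) _ ev2] card1 card2 by simp_all
  then have small: "card (insert d (set gs)) < card X" "card (insert d (X - set gs)) < card X"
    using card1 card2 by simp_all
  obtain D1 where D1: "D1 \<subseteq> insert d (set gs)" "D1 \<noteq> {}" "even_set (ends F) D1"
    by (rule even_transfer[OF subE(1) small(1) _ ev1]) auto
  obtain D2 where D2: "D2 \<subseteq> insert d (X - set gs)" "D2 \<noteq> {}" "even_set (ends F) D2"
    by (rule even_transfer[OF subE(2) small(2) _ ev2]) auto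
  \<comment> \<open>Without \<open>d\<close> either set would be a nonempty even subset of the tree.
    Hence \<open>d\<close> cancels in the sum, the sum is empty, and \<open>D1 = D2\<close> has room
    for \<open>d\<close> only.\<close>
  have "d \<in> D1" using D1 tree_indep gsX unfolding indep_def by (metis order_trans subset_insert)
  moreover have "d \<in> D2" using D2 tree_indep unfolding indep_def by (metis Diff_subset order_trans subset_insert)
  ultimately have "sym_diff D1 D2 \<subseteq> X" using D1(1) D2(1) gsX by blast
  then have "sym_diff D1 D2 = {}"
    using even_set_sym_diff[OF D1(3) D2(3)] tree_indep unfolding indep_def by metis
  then have "D1 \<subseteq> {d}" using D1(1) D2(1) by blast
  then have "card D1 \<le> 1" using card_mono[of "{d}" D1] by simp
  then show False using even_ge_3(2)[of D1] D1 subE(1) by auto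
qed

lemma theta_G:
  obtains vs es where "theta G vs es c x s1 s2" "set es = X - {x}" "length vs = card X"
proof -
  obtain vs es where p: "vpath (ends G) vs es" "hd vs = r1" "last vs = r2" "es \<noteq> []"
    "set es = X - {x}" "verts G = insert c (set vs)" "c \<notin> set vs" "length vs = card X"
    by (rule cycle_path)
  have "theta G vs es c x s1 s2" unfolding theta_def
    using p vpath_distinct_edges[OF p(1)] edges_G ends x spokes_not_in_X spokes(2)
    by (auto simp: insert_commute)
  then show ?thesis using p that by blast
qed

section \<open>The shape of \<open>F\<close>\<close>

lemma card_X_ge_3: "3 \<le> card X"
  using even_ge_3(1)[OF X_sub _ cycle_even] x by blast

lemma card_edges: "card (edges G) = Suc (Suc (card X))"
  unfolding edges_G using finX spokes_not_in_X spokes(2) by simp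

lemma theta_F_small:
  assumes "card X = 3"
  obtains ws fs y p q r where "theta F ws fs y p q r" "length fs = 2"
proof -
  have finV: "finite (verts F)" using wf(2) by (simp add: wf_graph_def)
  have "card (verts F) \<le> Suc (card X)"
    using finV finX tree_verts tree_linked by (intro connected_card_le[where f = "ends F"]) auto
  \<comment> \<open>Three vertices have only three pairs, too few for five edges.\<close>
  moreover have "\<not> card (verts F) \<le> 3"
  proof
    assume "card (verts F) \<le> 3"
    then have "card (verts F) * (card (verts F) - 1) \<le> 3 * 2" by (intro mult_le_mono) simp_all
    then have "card {A. A \<subseteq> verts F \<and> card A = 2} \<le> 3"
      using n_subsets[OF finV, of 2] by (simp add: choose_two)
    moreover have "card (ends F ` edges G) \<le> card {A. A \<subseteq> verts F \<and> card A = 2}"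
      using wf(2) finV edges_eq by (intro card_mono) (auto simp: wf_graph_def)
    ultimately show False using card_image[OF inj(2)] card_edges assms by simp
  qed
  ultimately have "card (verts F) = 4" using assms by simp
  moreover have "card (edges F) = 5" using card_edges edges_eq assms by simp
  ultimately show ?thesis using simple_graph_4_5_theta[OF simple(2)] that by blast
qed

text \<open>A smaller \<open>D\<close> would be dependent in \<open>G\<close> too. There
  \<open>s\<close> is the only edge of \<open>insert s X\<close> at \<open>c\<close>, so an even
  subset avoids \<open>s\<close> and lies in \<open>X\<close>. Transferred back to \<open>F\<close>,
  it contradicts the independence of the tree.\<close>

lemma even_spoke_card_ge:
  assumes D: "D \<subseteq> insert s X" "D \<noteq> {}" "even_set (ends F) D" and s: "s \<in> {s1, s2}"
  shows "card X \<le> card D"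
proof (rule ccontr)
  assume "\<not> card X \<le> card D"
  then have small: "card D < card X" by simp
  have DE: "D \<subseteq> edges G" using D(1) s edges_G by blast
  have "\<not> indep (ends F) D" using D by (auto simp: indep_def)
  then have "\<not> indep (ends G) D" using indep_transfer[OF DE small] by simp
  then obtain D' where D': "D' \<subseteq> D" "D' \<noteq> {}" "even_set (ends G) D'" by (auto simp: indep_def)
  have "s \<notin> D'"
  proof
    assume "s \<in> D'"
    moreover have cs: "c \<in> ends G s" using s ends by auto
    ultimately obtain e where e: "e \<in> D'" "e \<noteq> s" "c \<in> ends G e"
      using even_set_another_edge[OF D'(3)] by blast
    then have "e \<in> X" using D' D(1) by blast
    then show False using e(3) c by (auto simp: edge_induced_def)
  qed
  then have D'X: "D' \<subseteq> X" using D' D(1) by blast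
  have "card D' < card X" using small card_mono[of D D'] D'(1) D(3) by (simp add: even_set_def)
  moreover have "D' \<subseteq> edges G" using D'X X_sub by blast
  ultimately obtain D'' where "D'' \<subseteq> D'" "D'' \<noteq> {}" "even_set (ends F) D''"
    using even_transfer[of D'] D'(2,3) by metis
  then show False using tree_indep D'X by (auto simp: indep_def)
qed

lemma triangle_distinct: "x \<noteq> s1" "x \<noteq> s2"
  using x spokes_not_in_X by auto

text \<open>The triangle of \<open>G\<close> has fewer than \<open>card X\<close> edges, so some
  nonempty subset is even in \<open>F\<close>. As \<open>F\<close> is simple, this subset has three
  edges and is the whole triangle.\<close>

lemma triangle_even_F:
  assumes "4 \<le> card X"
  shows "even_set (ends F) {x, s1, s2}"
proof -
  have "vpath (ends G) [r1, c, r2] [s1, s2]"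
    using ends r_distinct by (auto simp: vpath_def less_Suc_eq)
  then have "even_set (ends G) (insert x (set [s1, s2]))"
    using triangle_distinct ends by (intro closed_vpath_even) auto
  then have ev: "even_set (ends G) {x, s1, s2}" by simp
  have card: "card {x, s1, s2} = 3" using triangle_distinct spokes(2) by simp
  have sub: "{x, s1, s2} \<subseteq> edges G" using x edges_G by blast
  obtain D where D: "D \<subseteq> {x, s1, s2}" "D \<noteq> {}" "even_set (ends F) D"
    by (rule even_transfer[OF sub _ _ ev]) (use card assms in auto)
  then have "3 \<le> card D" using even_ge_3(2)[of D] sub by blast
  then have "D = {x, s1, s2}" using D(1) card by (intro card_seteq) auto
  then show ?thesis using D(3) by simp
qed

lemma even_path_spoke_F:
  assumes "4 \<le> card X"
  shows "even_set (ends F) (insert s1 (X - {x})) \<or> even_set (ends F) (insert s2 (X - {x}))"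
proof -
  obtain a b where ab: "ends F s1 = {a, b}" "a \<noteq> b"
    using two(2)[OF spokes_edges(1)] by (meson card_2_iff)
  have "{a, b} \<subseteq> verts F" using wf(2) spokes_edges(1) edges_eq ab unfolding wf_graph_def by metis
  then have ln: "(a, b) \<in> (links (ends F) X)\<^sup>*" using tree_linked by blast
  obtain ws gs where g: "vpath (ends F) ws gs" "set gs \<subseteq> X" "hd ws = a" "last ws = b" "gs \<noteq> []"
    "even_set (ends F) (insert s1 (set gs))"
    by (rule linked_even_set[where f = "ends F" and x = s1 and A = X, OF spokes_not_in_X(1) ab ln])
  \<comment> \<open>The tree path in \<open>F\<close> between the ends of \<open>s1\<close>. By
    \<open>even_spoke_card_ge\<close> it omits at most one edge of \<open>X\<close>.\<close>
  define A where "A = set gs"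
  have A: "A \<subseteq> X" "even_set (ends F) (insert s1 A)" "finite A" using g finX by (auto simp: A_def)
  have sA: "s1 \<notin> A" "s2 \<notin> A" using A(1) spokes_not_in_X by blast+
  have ge1: "card X \<le> Suc (card A)"
    using even_spoke_card_ge[of "insert s1 A" s1] A sA by auto
  show ?thesis
  proof (cases "x \<in> A")
    case True
    \<comment> \<open>Adding the triangle trades \<open>x\<close> and \<open>s1\<close> for
      \<open>s2\<close>. The size bound applied to the result leaves only
      \<open>A = X\<close>.\<close>
    have ev: "even_set (ends F) (sym_diff (insert s1 A) {x, s1, s2})"
      using even_set_sym_diff[OF A(2) triangle_even_F[OF assms]] .
    have eq: "sym_diff (insert s1 A) {x, s1, s2} = insert s2 (A - {x})"
      using True sA spokes(2) by blast
    have "card X \<le> card (insert s2 (A - {x}))"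
      using even_spoke_card_ge[of "insert s2 (A - {x})" s2] ev A(1) unfolding eq by blast
    also have "\<dots> = card A" using sA A(3) True by simp (metis card_Suc_Diff1 card_Diff_singleton One_nat_def)
    finally have "A = X" using A(1) finX by (simp add: card_seteq)
    then show ?thesis using ev unfolding eq by simp
  next
    case False
    then have "A \<subseteq> X - {x}" using A(1) by blast
    moreover have "card (X - {x}) \<le> card A" using ge1 finX x by simp
    ultimately have "A = X - {x}" using finX by (simp add: card_seteq)
    then show ?thesis using A(2) by simp
  qed
qed

text \<open>In \<open>F\<close> the edge \<open>s2\<close> takes over the role that \<open>x\<close>
  has in \<open>G\<close>: it joins the ends of the path formed by \<open>X - {x}\<close>, while
  \<open>s1\<close> and \<open>x\<close> run through the extra vertex \<open>y\<close>.\<close>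

lemma theta_F_large:
  assumes "4 \<le> card X" and ev: "even_set (ends F) (insert s2 (X - {x}))"
  obtains ws fs y where "theta F ws fs y s2 s1 x" "set fs = X - {x}"
proof -
  have sub: "{s2, s1, x} \<subseteq> edges G" using x edges_G by blast
  obtain a b y where t: "ends F s2 = {a, b}" "ends F s1 = {a, y}" "ends F x = {b, y}"
    "a \<noteq> b" "a \<noteq> y" "b \<noteq> y"
  proof (rule even_set_triangle[of "ends F" s2 s1 x])
    show "even_set (ends F) {s2, s1, x}"
      using triangle_even_F[OF assms(1)] by (simp add: insert_commute)
    show "inj_on (ends F) {s2, s1, x}" using inj(2) sub by (rule inj_on_subset)
    show "\<And>e. e \<in> {s2, s1, x} \<Longrightarrow> card (ends F e) = 2" using two(2) sub by blast
  qed (use triangle_distinct spokes(2) in auto)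
  have ns: "s2 \<notin> X - {x}" using spokes_not_in_X by blast
  have twoD: "card (ends F e) = 2" if "e \<in> insert s2 (X - {x})" for e
    using that two(2) X_sub spokes_edges by blast
  have "(a, b) \<in> (links (ends F) (insert s2 (X - {x}) - {s2}))\<^sup>*"
    using ev _ t(1) twoD by (rule even_set_reconnects) simp
  then have ln: "(a, b) \<in> (links (ends F) (X - {x}))\<^sup>*" using ns by simp
  obtain ws fs where p: "vpath (ends F) ws fs" "set fs \<subseteq> X - {x}" "hd ws = a" "last ws = b"
    "fs \<noteq> []" "even_set (ends F) (insert s2 (set fs))"
    by (rule linked_even_set[where f = "ends F" and x = s2 and A = "X - {x}", OF ns t(1,4) ln])
  have "card X \<le> card (insert s2 (set fs))"
    using even_spoke_card_ge[of "insert s2 (set fs)" s2] p(2,6) by blast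
  moreover have "card (insert s2 (set fs)) = Suc (card (set fs))" using ns p(2) by (subst card_insert_disjoint) auto
  ultimately have "card (X - {x}) \<le> card (set fs)" using finX x by simp
  then have fs: "set fs = X - {x}" using p(2) finX by (simp add: card_seteq)
  have bw: "b \<in> set ws" using p(4) vpath_nonempty[OF p(1)] by auto
  \<comment> \<open>Otherwise \<open>x\<close> would close a cycle with part of the path, inside the
    tree \<open>X\<close>.\<close>
  have yw: "y \<notin> set ws"
  proof
    assume "y \<in> set ws"
    then have ln: "(b, y) \<in> (links (ends F) (X - {x}))\<^sup>*"
      using vpath_linked[OF p(1) bw] fs by simp
    have nx: "x \<notin> X - {x}" by simp
    obtain us gs where "vpath (ends F) us gs" "set gs \<subseteq> X - {x}" "hd us = b" "last us = y"
      "gs \<noteq> []" "even_set (ends F) (insert x (set gs))"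
      by (rule linked_even_set[where f = "ends F" and x = x and A = "X - {x}", OF nx t(3,6) ln])
    then show False using tree_indep x unfolding indep_def by blast
  qed
  have "verts F = \<Union>(ends F ` set fs) \<union> ends F x" using tree_verts x fs by blast
  also have "\<dots> = insert y (set ws)" using vpath_vertices[OF p(1,5)] t(3) bw by auto
  finally have V: "verts F = insert y (set ws)" .
  have "edges F = set (fs @ [s2, s1, x])" using edges_eq edges_G fs x by auto
  then have "theta F ws fs y s2 s1 x" unfolding theta_def
    using p(1,3,4) V yw t vpath_distinct_edges[OF p(1)] fs spokes_not_in_X spokes(2) triangle_distinct
    by simp
  then show ?thesis using that fs by blast
qed

lemma conclusion_large:
  assumes "4 \<le> card X" and ev: "even_set (ends F) (insert s2 (X - {x}))"
  shows "isomorphic G F \<and>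
    (\<exists>H. switches_and_exchange x {s1, s2} G H \<and> same_up_to_vertex_names H F) \<and>
    two_connected G \<and> two_connected F"
proof -
  obtain vs es where G: "theta G vs es c x s1 s2" "set es = X - {x}" "length vs = card X"
    by (rule theta_G)
  obtain ws fs y where F: "theta F ws fs y s2 s1 x" "set fs = X - {x}"
    by (rule theta_F_large[OF assms])
  have "card (X - {x}) \<noteq> 0" using card_X_ge_3 x finX by simp
  then have ne: "es \<noteq> []" "fs \<noteq> []" using G(2) F(2) by (metis card.empty list.set(1))+
  have d: "distinct es" "distinct fs" using G(1) F(1) by (auto simp: theta_def)
  then have "length es = length fs" using G(2) F(2) by (metis distinct_card)
  then have "isomorphic G F" using theta_isomorphic[OF G(1) F(1)] by blast
  \<comment> \<open>After the exchange the special edges have the same roles as in \<open>F\<close>;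
    only the order along the long path may differ, and the switches repair it.\<close>
  moreover have "theta (exchange_edges x s2 G) vs es c s2 s1 x" using G(1) by (rule theta_exchange)
  then obtain H where H: "whitney_switch\<^sup>*\<^sup>* (exchange_edges x s2 G) H" "theta H vs fs c s2 s1 x"
    using theta_switches_permute[OF _ d(2)] G(2) F(2) by metis
  \<comment> \<open>The series before the exchange is empty: \<open>G1 = G\<close>.\<close>
  have "switches_and_exchange x {s1, s2} G H" unfolding switches_and_exchange_def
    using H(1) by blast
  moreover have "same_up_to_vertex_names H F" using H(2) F(1) by (rule theta_same_up_to_vertex_names)
  moreover have "two_connected G" "two_connected F"
    using theta_two_connected[OF conn(1) G(1) ne(1)] theta_two_connected[OF conn(2) F(1) ne(2)] .
  ultimately show ?thesis by blast
qed

lemma swap_spokes: "cycle_tree_pair G F X c r2 r1 s2 s1 x"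
proof
  show "{e \<in> edges G. c \<in> ends G e} = {s2, s1}" "ends G x = {r2, r1}"
    using spokes(1) ends(3) by (simp_all add: insert_commute)
qed (use simple conn edges_eq trunc X_sub cycle verts_cycle tree c spokes(2) ends x in simp_all)

text \<open>For \<open>card X = 3\<close> both graphs are theta graphs with a long path of two
  edges, and the conjunct on switches is vacuous as \<open>G\<close> has four vertices. Otherwise
  the case of \<open>s1\<close> is that of \<open>s2\<close> with the spokes renamed.\<close>

lemma conclusion:
  shows "isomorphic G F \<and>
    (5 \<le> card (verts G) \<longrightarrow>
      (\<exists>H. switches_and_exchange x {s1, s2} G H \<and> same_up_to_vertex_names H F)) \<and>
    two_connected G \<and> two_connected F"
proof (cases "card X = 3")
  case True
  obtain vs es where G: "theta G vs es c x s1 s2" "set es = X - {x}" "length vs = card X"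
    by (rule theta_G)
  obtain ws fs y p q r where F: "theta F ws fs y p q r" "length fs = 2"
    by (rule theta_F_small[OF True])
  have "length es = 2" using G(1,3) True by (simp add: theta_def vpath_def)
  moreover from this have "es \<noteq> []" "fs \<noteq> []" using F(2) by auto
  ultimately show ?thesis
    using theta_isomorphic[OF G(1) F(1)] F(2) theta_two_connected[OF conn(1) G(1)]
      theta_two_connected[OF conn(2) F(1)] card_verts True by simp
next
  case False
  then have large: "4 \<le> card X" using card_X_ge_3 by simp
  show ?thesis
  proof (cases "even_set (ends F) (insert s2 (X - {x}))")
    case True
    then show ?thesis using conclusion_large[OF large] by blast
  next
    case False
    then have "even_set (ends F) (insert s1 (X - {x}))" using even_path_spoke_F[OF large] by blast
    then show ?thesis using cycle_tree_pair.conclusion_large[OF swap_spokes large]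
      by (metis insert_commute)
  qed
qed

end

theorem claim3p9:
  fixes G :: "('v, 'e) mgraph" and F :: "('w, 'e) mgraph"
    and X :: "'e set" and R :: "('v, 'e) mgraph"
    and c r1 r2 :: 'v and s1 s2 x :: 'e
  assumes "simple_graph G" and "connected_graph G"
    and "simple_graph F" and "connected_graph F"
    and "edges G = edges F"
    and "truncation (cycle_matroid G) = truncation (cycle_matroid F)"
    and "cycle_matroid G \<noteq> cycle_matroid F"
    and "X \<subseteq> edges G"
    and "R = edge_induced G X"
    and "quasi_hamiltonian_cycle R G"
    and "spanning_tree (edge_induced F X) F"
    and "c \<in> verts G" and "c \<notin> verts R"
    and "{e \<in> edges G. c \<in> ends G e} = {s1, s2}" and "s1 \<noteq> s2"
    and "r1 \<in> verts R" and "ends G s1 = {c, r1}"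
    and "r2 \<in> verts R" and "ends G s2 = {c, r2}"
    and "x \<in> edges R" and "ends G x = {r1, r2}"
  shows "isomorphic G F \<and>
    (card (verts G) \<ge> 5 \<longrightarrow>
      (\<exists>H. switches_and_exchange x {s1, s2} G H \<and> same_up_to_vertex_names H F)) \<and>
    two_connected G \<and> two_connected F"
proof -
  obtain q where "is_cycle R" "q \<in> verts G" "verts R = verts G - {q}"
    using assms(10) by (auto simp: quasi_hamiltonian_cycle_def)
  \<comment> \<open>The vertex \<open>q\<close> missed by the cycle must be
    \<open>c\<close>.\<close>
  moreover from this have "verts G = insert c (verts R)" using assms(12,13) by blast
  moreover have "x \<in> X" using assms(9,20) by (simp add: edge_induced_def)
  ultimately interpret cycle_tree_pair G F X c r1 r2 s1 s2 x
    using assms by unfold_locales simp_all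
  show ?thesis by (rule conclusion)
qed

end
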